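(* Let $s\in(1/2,1)$ and let $w$ be a mother wave packet with parameter $d$ as in the context. For a function $f(t)$ and $\varepsilon>0$ define $$R_\varepsilon=\{(a,b): |W_f(a,b)|\ge |a|^{-s/2}\sqrt{\varepsilon}\}$$ and $$Z_{n,k}=\{(a,b): |a-nN_k\phi_k'(b)|\le d|a|^s\}\qquad\text{for } 1\le k\le K \text{ and } |n|\ge 1.$$ For fixed $M$ and $K$ and for any $\varepsilon>0$, there exists a constant $N_0(M,K,s,\varepsilon)>0$ such that for any $N>N_0(M,K,s,\varepsilon)$ and any $f(t)=\sum_{k=1}^K\alpha_k(t)s_k(2\pi N_k\phi_k(t))\in GF(M,N,K,s)$ the following statements hold. (i) The sets $\{Z_{n,k}: 1\le k\le K,\ \widehat{s_k}(n)\ne 0\}$ are disjoint, and $R_\varepsilon\subset\bigcup_{1\le k\le K}\bigcup_{\widehat{s_k}(n)\neq 0}Z_{n,k}$. (ii) For any $(a,b)\in R_\varepsilon\cap Z_{n,k}$, $$\frac{|v_f(a,b)-nN_k\phi_k'(b)|}{|nN_k\phi_k'(b)|}\lesssim\sqrt{\varepsilon},$$ where the implicit constant may depend on $M$ and $K$.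
   Context: Fourier transform: $\widehat g(\xi)=\int_{\mathbb R} g(t)e^{-2\pi i t\xi}\,dt$. For a $2\pi$-periodic function $\sigma$, $\widehat{\sigma}(n)$ ($n\in\mathbb Z$) are its Fourier coefficients, $\sigma(t)=\sum_n\widehat{\sigma}(n)e^{int}$. The scalar $s\in(1/2,1)$ is a geometric scaling parameter, not to be confused with the shape functions $s_k$. Wave packets: the mother wave packet $w$ is a fixed function in the Schwartz class whose Fourier transform $\widehat w$ is real-valued, non-negative and smooth with support equal to $(-d,d)$, where $d\le1$. For $|a|\ge1$, $b\in\mathbb R$, $$w_{ab}(t)=|a|^{s/2}w(|a|^s(t-b))e^{2\pi i(t-b)a},\qquad W_f(a,b)=\int_{\mathbb R}\overline{w_{ab}(t)}f(t)\,dt .$$ The instantaneous frequency information function is $v_f(a,b)=\dfrac{\partial_bW_f(a,b)}{2\pi i\,W_f(a,b)}$ if $|W_f(a,b)|>0$, and $v_f(a,b)=\infty$ otherwise. Shape functions: $\mathcal S_M$ consists of the $2\pi$-periodic functions $\sigma$ in the Wiener algebra with unit $L^2([-\pi,\pi])$-norm and $L^\infty$-norm bounded by $M$ such that (1) the Fourier series of $\sigma$ is uniformly convergent; (2) $\sum_{n}|\widehat\sigma(n)|\le M$ and $\widehat\sigma(0)=0$; (3) the greatest common divisor of the elements of $\{|n|:\widehat\sigma(n)\ne0\}$ is $1$. A function $\alpha(t)\sigma(2\pi N\phi(t))$ is a general intrinsic mode type function (GIMT) of type $(M,N)$ if $\sigma\in\mathcal S_M$, $\alpha\in C^\infty$,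 $|\alpha'|\le M$, $1/M\le\alpha\le M$, and $\phi\in C^\infty$, $1/M\le|\phi'|\le M$, $|\phi''|\le M$. $GF(M,N,K,s)$ (well-separated general superpositions of type $(M,N,K,s)$) is the set of all $f=\sum_{k=1}^Kf_k$ where each $f_k(t)=\alpha_k(t)s_k(2\pi N_k\phi_k(t))$ is a GIMT of type $(M,N_k)$ with $N_k\ge N$, and the phase functions satisfy the separation condition: for any pair $(a,b)$ there exists at most one pair $(n,k)$ such that $\widehat{s_k}(n)\ne0$ and $|a|^{-s}|a-nN_k\phi_k'(b)|<d$.
   Formalization: In (i), since the sets Z_{n,k} are closed while the separation condition is strict (so two may touch along a boundary), disjointness is stated for the interiors of the Z_{n,k} and for the sets R_ε ∩ Z_{n,k}. *)

theory Defs
  imports "HOL-Analysis.Analysis"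
begin

definition nth_vderiv :: "nat \<Rightarrow> (real \<Rightarrow> 'a::real_normed_vector) \<Rightarrow> real \<Rightarrow> 'a" where
  "nth_vderiv n f = ((\<lambda>g x. vector_derivative g (at x)) ^^ n) f"

definition smooth :: "(real \<Rightarrow> 'a::real_normed_vector) \<Rightarrow> bool" where
  "smooth f \<longleftrightarrow> (\<forall>n x. nth_vderiv n f differentiable (at x))"

definition schwartz :: "(real \<Rightarrow> complex) \<Rightarrow> bool" where
  "schwartz f \<longleftrightarrow> smooth f \<and>
     (\<forall>j n. \<exists>C. \<forall>x. \<bar>x\<bar> ^ j * cmod (nth_vderiv n f x) \<le> C)"

definition fourier :: "(real \<Rightarrow> complex) \<Rightarrow> real \<Rightarrow> complex" where
  "fourier g \<xi> = (LINT t|lborel. g t * cis (- 2 * pi * t * \<xi>))"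

definition fourier_coeff :: "(real \<Rightarrow> complex) \<Rightarrow> int \<Rightarrow> complex" where
  "fourier_coeff \<sigma> n = (LINT t:{-pi..pi}|lborel. \<sigma> t * cis (- (of_int n * t))) / of_real (2 * pi)"

(* The support of the transform is the open interval (-d,d), so "support" here is the set
   where the transform does not vanish, without taking the closure. *)
definition mother_wave_packet :: "(real \<Rightarrow> complex) \<Rightarrow> real \<Rightarrow> bool" where
  "mother_wave_packet w d \<longleftrightarrow> 0 < d \<and> d \<le> 1 \<and> schwartz w \<and>
     (\<forall>\<xi>. fourier w \<xi> \<in> \<real>\<^sub>\<ge>\<^sub>0) \<and> smooth (fourier w) \<and>
     {\<xi>. fourier w \<xi> \<noteq> 0} = {-d<..<d}"

definition wave_packet :: "(real \<Rightarrow> complex) \<Rightarrow> real \<Rightarrow> real \<Rightarrow> real \<Rightarrow> real \<Rightarrow> complex" where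
  "wave_packet w s a b t =
     of_real (\<bar>a\<bar> powr (s / 2)) * w (\<bar>a\<bar> powr s * (t - b)) * cis (2 * pi * (t - b) * a)"

definition wp_transform ::
  "(real \<Rightarrow> complex) \<Rightarrow> real \<Rightarrow> (real \<Rightarrow> complex) \<Rightarrow> real \<Rightarrow> real \<Rightarrow> complex" where
  "wp_transform w s f a b = (LINT t|lborel. cnj (wave_packet w s a b t) * f t)"

(* The value None stands for infinity. *)
definition inst_freq ::
  "(real \<Rightarrow> complex) \<Rightarrow> real \<Rightarrow> (real \<Rightarrow> complex) \<Rightarrow> real \<Rightarrow> real \<Rightarrow> complex option" where
  "inst_freq w s f a b =
     (if cmod (wp_transform w s f a b) > 0
      then Some (vector_derivative (\<lambda>b'. wp_transform w s f a b') (at b) /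
                 (2 * of_real pi * \<i> * wp_transform w s f a b))
      else None)"

(* Functions on the circle are represented by 2 pi-periodic functions on the line; elements of
   the Wiener algebra by their continuous representatives. *)
definition wiener_algebra :: "(real \<Rightarrow> complex) set" where
  "wiener_algebra = {\<sigma>. (\<forall>t. \<sigma> (t + 2 * pi) = \<sigma> t) \<and> continuous_on UNIV \<sigma> \<and>
     (\<lambda>n. cmod (fourier_coeff \<sigma> n)) summable_on UNIV}"

definition shape_functions :: "real \<Rightarrow> (real \<Rightarrow> complex) set" where
  "shape_functions M = {\<sigma> \<in> wiener_algebra.
     sqrt (LINT t:{-pi..pi}|lborel. (cmod (\<sigma> t))\<^sup>2) = 1 \<and>
     (AE t in lborel. cmod (\<sigma> t) \<le> M) \<and>
     uniform_limit UNIV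
       (\<lambda>m t. \<Sum>n\<in>{- int m..int m}. fourier_coeff \<sigma> n * cis (of_int n * t)) \<sigma> sequentially \<and>
     (\<Sum>\<^sub>\<infinity>n. cmod (fourier_coeff \<sigma> n)) \<le> M \<and> fourier_coeff \<sigma> 0 = 0 \<and>
     Gcd {nat \<bar>n\<bar> |n. fourier_coeff \<sigma> n \<noteq> 0} = 1}"

definition gimt :: "real \<Rightarrow> (real \<Rightarrow> real) \<Rightarrow> (real \<Rightarrow> complex) \<Rightarrow> (real \<Rightarrow> real) \<Rightarrow> bool" where
  "gimt M \<alpha> \<sigma> \<phi> \<longleftrightarrow> \<sigma> \<in> shape_functions M \<and>
     smooth \<alpha> \<and> (\<forall>t. \<bar>deriv \<alpha> t\<bar> \<le> M \<and> 1 / M \<le> \<alpha> t \<and> \<alpha> t \<le> M) \<and>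
     smooth \<phi> \<and> (\<forall>t. 1 / M \<le> \<bar>deriv \<phi> t\<bar> \<and> \<bar>deriv \<phi> t\<bar> \<le> M \<and> \<bar>deriv (deriv \<phi>) t\<bar> \<le> M)"

definition gimt_fun ::
  "real \<Rightarrow> (real \<Rightarrow> real) \<Rightarrow> (real \<Rightarrow> complex) \<Rightarrow> (real \<Rightarrow> real) \<Rightarrow> real \<Rightarrow> complex" where
  "gimt_fun N \<alpha> \<sigma> \<phi> t = of_real (\<alpha> t) * \<sigma> (2 * pi * N * \<phi> t)"

(* A member of GF(M,N,K,s) is the function "superposition K Ns \<alpha> sh \<phi>" for data satisfying
   "GF_data d M N K s Ns \<alpha> sh \<phi>". The bands Z_{n,k} and the conclusions refer to these data,
   not only to the function. The parameter d is that of the mother wave packet, and (a,b)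
   ranges over the domain |a| >= 1 of the wave packet transform. *)
definition superposition ::
  "nat \<Rightarrow> (nat \<Rightarrow> real) \<Rightarrow> (nat \<Rightarrow> real \<Rightarrow> real) \<Rightarrow> (nat \<Rightarrow> real \<Rightarrow> complex) \<Rightarrow>
   (nat \<Rightarrow> real \<Rightarrow> real) \<Rightarrow> real \<Rightarrow> complex" where
  "superposition K Ns \<alpha> sh \<phi> t = (\<Sum>k=1..K. gimt_fun (Ns k) (\<alpha> k) (sh k) (\<phi> k) t)"

definition active :: "nat \<Rightarrow> (nat \<Rightarrow> real \<Rightarrow> complex) \<Rightarrow> (int \<times> nat) set" where
  "active K sh = {(n, k). k \<in> {1..K} \<and> fourier_coeff (sh k) n \<noteq> 0}"

definition GF_data ::
  "real \<Rightarrow> real \<Rightarrow> real \<Rightarrow> nat \<Rightarrow> real \<Rightarrow> (nat \<Rightarrow> real) \<Rightarrow> (nat \<Rightarrow> real \<Rightarrow> real) \<Rightarrow>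
   (nat \<Rightarrow> real \<Rightarrow> complex) \<Rightarrow> (nat \<Rightarrow> real \<Rightarrow> real) \<Rightarrow> bool" where
  "GF_data d M N K s Ns \<alpha> sh \<phi> \<longleftrightarrow>
     (\<forall>k\<in>{1..K}. gimt M (\<alpha> k) (sh k) (\<phi> k) \<and> N \<le> Ns k) \<and>
     (\<forall>a b. 1 \<le> \<bar>a\<bar> \<longrightarrow>
        (\<exists>\<^sub>\<le>\<^sub>1 p. p \<in> active K sh \<and>
           (case p of (n, k) \<Rightarrow>
             \<bar>a\<bar> powr (- s) * \<bar>a - of_int n * Ns k * deriv (\<phi> k) b\<bar> < d)))"

definition R_set ::
  "(real \<Rightarrow> complex) \<Rightarrow> real \<Rightarrow> (real \<Rightarrow> complex) \<Rightarrow> real \<Rightarrow> (real \<times> real) set" where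
  "R_set w s f \<epsilon> =
     {(a, b). 1 \<le> \<bar>a\<bar> \<and> cmod (wp_transform w s f a b) \<ge> \<bar>a\<bar> powr (- s / 2) * sqrt \<epsilon>}"

(* The bands are closed while the separation condition is strict, so two bands of separated data
   can touch along a common boundary; only their interiors, and their parts inside R_set, are
   disjoint in general. *)
definition Z_set ::
  "real \<Rightarrow> real \<Rightarrow> (nat \<Rightarrow> real) \<Rightarrow> (nat \<Rightarrow> real \<Rightarrow> real) \<Rightarrow> int \<Rightarrow> nat \<Rightarrow> (real \<times> real) set" where
  "Z_set d s Ns \<phi> n k =
     {(a, b). \<bar>a - of_int n * Ns k * deriv (\<phi> k) b\<bar> \<le> d * \<bar>a\<bar> powr s}"

end

theory Submission
  imports Defs "HOL-Probability.Sinc_Integral" "HOL-Real_Asymp.Real_Asymp"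
begin

text \<open>
  Expand every shape function in its Fourier series. The signal becomes a sum of oscillations
  \<open>\<alpha>\<^sub>k e\<^bsup>2 \<pi> \<i> n N\<^sub>k \<phi>\<^sub>k\<^esup>\<close> with summable coefficients, and the theorem follows from one fact about a single
  oscillation: its transform, divided by \<open>\<bar>a\<bar>\<^bsup>-s/2\<^esup>\<close>, tends to zero uniformly as \<open>N\<close> grows, as long as
  \<open>(a, b)\<close> stays out of its open band \<open>\<bar>a - n N\<^sub>k \<phi>\<^sub>k'(b)\<bar> < d \<bar>a\<bar>\<^sup>s\<close> (\<open>pairing_oscillation_bound\<close>). On the scale
  \<open>\<bar>a\<bar>\<^bsup>-s\<^esup>\<close> of the packet, an oscillation of frequency comparable to \<open>a\<close> is a pure exponential up to an error
  of order \<open>\<bar>a\<bar>\<^bsup>1-2s\<^esup>\<close>, small because \<open>s > 1/2\<close>; it contributes a value of the Fourier transform of \<open>w\<close>,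
  which vanishes off the band. An oscillation of incomparable frequency has no stationary point against
  the packet, and one integration by parts gains a factor of order \<open>N\<^bsup>s-1\<^esup>\<close>. Hence a point where the
  transform exceeds the threshold lies in an open band of some active mode.

  Disjointness is then a matter of geometry. The separation condition speaks of open bands, while the
  sets \<open>Z\<close> are closed. Since \<open>s < 1\<close>, the width of a band changes more slowly in \<open>a\<close> than the distance to its
  centre, so interior points of a closed band lie in the open one (\<open>interior_Z_set\<close>), and a point of a
  closed band that also lies in another open band can be moved into both open bands
  (\<open>closed_band_meets_open_band\<close>).

  The estimate of the instantaneous frequency needs no asymptotics of the transform. Differentiating the
  packet in \<open>b\<close> gives \<open>2 \<pi> \<i> a\<close> times the transform and \<open>\<bar>a\<bar>\<^sup>s\<close> times the transform with envelope \<open>w'\<close>. The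
  latter is trivially bounded by a multiple of \<open>\<bar>a\<bar>\<^bsup>-s/2\<^esup>\<close>, and the transform is at least \<open>\<bar>a\<bar>\<^bsup>-s/2\<^esup> \<epsilon>\<^bsup>1/2\<^esup>\<close> by
  hypothesis, so the instantaneous frequency is within \<open>O(\<bar>a\<bar>\<^sup>s)\<close> of \<open>a\<close> (\<open>inst_freq_near_packet_frequency\<close>).
  In a band, \<open>a\<close> is within \<open>\<bar>a\<bar>\<^sup>s\<close> of the centre. Relative to \<open>\<bar>a\<bar>\<close>, which is at least of order \<open>N\<close>, both errors are
  \<open>O(\<bar>a\<bar>\<^bsup>s-1\<^esup>)\<close>.
\<close>

section \<open>Smooth and rapidly decreasing functions\<close>

lemma nth_vderiv_0 [simp]: "nth_vderiv 0 f = f"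
  by (simp add: nth_vderiv_def)

lemma smooth_has_vector_derivative:
  assumes "smooth f"
  shows "(nth_vderiv n f has_vector_derivative nth_vderiv (Suc n) f x) (at x)"
  using assms by (auto simp: smooth_def nth_vderiv_def vector_derivative_works)

lemma smooth_continuous:
  assumes "smooth f"
  shows "continuous_on UNIV (nth_vderiv n f)"
  using smooth_has_vector_derivative[OF assms]
  by (meson continuous_at_imp_continuous_on has_vector_derivative_continuous)

lemma deriv_eq_nth_vderiv:
  fixes f :: "real \<Rightarrow> real"
  shows "deriv f = nth_vderiv 1 f" "deriv (deriv f) = nth_vderiv 2 f"
proof -
  have "deriv g = (\<lambda>x. vector_derivative g (at x))" for g :: "real \<Rightarrow> real"
    by (simp add: fun_eq_iff field_derivative_eq_vector_derivative)
  then show "deriv f = nth_vderiv 1 f" "deriv (deriv f) = nth_vderiv 2 f"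
    by (simp_all add: nth_vderiv_def numeral_2_eq_2)
qed

lemma smooth_real_derivatives:
  fixes f :: "real \<Rightarrow> real"
  assumes "smooth f"
  shows "(f has_real_derivative deriv f x) (at x)"
    and "(deriv f has_real_derivative deriv (deriv f) x) (at x)"
    and "continuous_on UNIV f" "continuous_on UNIV (deriv f)" "continuous_on UNIV (deriv (deriv f))"
  using smooth_has_vector_derivative[OF assms, of 0 x] smooth_has_vector_derivative[OF assms, of 1 x]
    smooth_continuous[OF assms, of 0] smooth_continuous[OF assms, of 1]
    smooth_continuous[OF assms, of 2]
  unfolding deriv_eq_nth_vderiv(2)[of f] unfolding deriv_eq_nth_vderiv(1)[of f]
  by (simp_all add: has_real_derivative_iff_has_vector_derivative numeral_2_eq_2)

lemma integrable_inverse_quadratic: "integrable lborel (\<lambda>x::real. inverse (1 + x\<^sup>2))"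
  using integrable_inverse_1_plus_square
  by (simp add: set_integrable_def einterval_eq)

lemma integrable_of_quadratic_decay:
  fixes f :: "real \<Rightarrow> 'a::{banach, second_countable_topology}"
  assumes "continuous_on UNIV f" and "\<And>x. norm (f x) \<le> D / (1 + x\<^sup>2)"
  shows "integrable lborel f"
proof (rule Bochner_Integration.integrable_bound)
  show "integrable lborel (\<lambda>x::real. D * inverse (1 + x\<^sup>2))"
    by (intro integrable_mult_right integrable_inverse_quadratic)
  show "f \<in> borel_measurable lborel"
    using borel_measurable_continuous_onI[OF assms(1)] by simp
  show "AE x in lborel. norm (f x) \<le> norm (D * inverse (1 + x\<^sup>2))"
  proof (intro AE_I2)
    fix x
    have "D / (1 + x\<^sup>2) \<le> norm (D * inverse (1 + x\<^sup>2))"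
      by (metis abs_ge_self divide_inverse real_norm_def)
    with assms(2)[of x] show "norm (f x) \<le> norm (D * inverse (1 + x\<^sup>2))" by linarith
  qed
qed

text \<open>The rate \<open>1 / (1 + x\<^sup>2)\<close> is the integrable majorant used throughout; it is available for \<open>x\<^sup>2 w\<close>
  as well, through the weight \<open>x\<^sup>4\<close> in the definition of a Schwartz function.\<close>
lemma schwartz_decay:
  assumes "schwartz w"
  obtains D where "\<And>x. cmod (nth_vderiv n w x) \<le> D / (1 + x\<^sup>2)"
    and "\<And>x. x\<^sup>2 * cmod (nth_vderiv n w x) \<le> D / (1 + x\<^sup>2)"
proof -
  have "\<forall>j. \<exists>C. \<forall>x. \<bar>x\<bar> ^ j * cmod (nth_vderiv n w x) \<le> C"
    using assms unfolding schwartz_def by blast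
  then obtain C where C: "\<And>j x. \<bar>x\<bar> ^ j * cmod (nth_vderiv n w x) \<le> C j"
    by metis
  have pow: "cmod (nth_vderiv n w x) \<le> C 0" "x\<^sup>2 * cmod (nth_vderiv n w x) \<le> C 2"
    "x^4 * cmod (nth_vderiv n w x) \<le> C 4" for x
    using C[of x 0] C[of x 2] C[of x 4] by (simp_all)
  have pos: "0 \<le> C 0" "0 \<le> C 2" "0 \<le> C 4"
    using order_trans[OF _ pow(1)[of 0]] order_trans[OF _ pow(2)[of 0]] order_trans[OF _ pow(3)[of 0]]
    by auto
  let ?D = "C 0 + C 2 + C 4"
  have "cmod (nth_vderiv n w x) \<le> ?D / (1 + x\<^sup>2)" for x
  proof -
    have "cmod (nth_vderiv n w x) * (1 + x\<^sup>2) \<le> ?D"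
      using pow[of x] pos by (simp add: algebra_simps)
    then show ?thesis by (simp add: pos_le_divide_eq add_pos_nonneg)
  qed
  moreover have "x\<^sup>2 * cmod (nth_vderiv n w x) \<le> ?D / (1 + x\<^sup>2)" for x
  proof -
    have "x\<^sup>2 * cmod (nth_vderiv n w x) * (1 + x\<^sup>2)
      = x\<^sup>2 * cmod (nth_vderiv n w x) + x^4 * cmod (nth_vderiv n w x)"
      by (simp add: algebra_simps power2_eq_square power4_eq_xxxx)
    also have "\<dots> \<le> ?D" using pow[of x] pos by linarith
    finally show ?thesis by (simp add: pos_le_divide_eq add_pos_nonneg)
  qed
  ultimately show thesis by (rule that)
qed

lemma schwartz_integrable:
  assumes "schwartz w"
  shows "integrable lborel (nth_vderiv n w)"
    and "integrable lborel (\<lambda>x. x\<^sup>2 * cmod (nth_vderiv n w x))"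
proof -
  obtain D where D: "\<And>x. cmod (nth_vderiv n w x) \<le> D / (1 + x\<^sup>2)"
    "\<And>x. x\<^sup>2 * cmod (nth_vderiv n w x) \<le> D / (1 + x\<^sup>2)"
    using schwartz_decay[OF assms] by metis
  have cont: "continuous_on UNIV (nth_vderiv n w)"
    using assms smooth_continuous by (auto simp: schwartz_def)
  show "integrable lborel (nth_vderiv n w)"
    by (rule integrable_of_quadratic_decay[OF cont D(1)])
  show "integrable lborel (\<lambda>x. x\<^sup>2 * cmod (nth_vderiv n w x))"
    by (rule integrable_of_quadratic_decay[where D = D])
      (use D(2) in \<open>auto intro!: continuous_intros cont\<close>)
qed

lemma tendsto_0_of_quadratic_decay:
  fixes f :: "real \<Rightarrow> 'a::real_normed_vector"
  assumes "\<And>x. norm (f x) \<le> D / (1 + x\<^sup>2)"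
  shows "(f \<longlongrightarrow> 0) at_top" "(f \<longlongrightarrow> 0) at_bot"
proof -
  have "((\<lambda>x::real. D / (1 + x\<^sup>2)) \<longlongrightarrow> 0) at_top" by real_asymp
  then show "(f \<longlongrightarrow> 0) at_top"
    by (rule Lim_null_comparison[rotated]) (use assms in auto)
  have "((\<lambda>x::real. D / (1 + x\<^sup>2)) \<longlongrightarrow> 0) at_bot" by real_asymp
  then show "(f \<longlongrightarrow> 0) at_bot"
    by (rule Lim_null_comparison[rotated]) (use assms in auto)
qed

section \<open>Oscillatory integrals\<close>

lemma has_vector_derivative_cis:
  assumes "(g has_real_derivative g') (at x)"
  shows "((\<lambda>x. cis (g x)) has_vector_derivative of_real g' * (\<i> * cis (g x))) (at x)"
  using has_derivative_cis[of g "(*) g'" x UNIV] assms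
  by (simp add: has_vector_derivative_def has_field_derivative_def scaleR_conv_of_real ac_simps)

text \<open>Without stationary points, one integration by parts gains a power of the phase derivative:
  \<open>F e\<^sup>i\<^sup>g\<close> differs from the derivative of \<open>F e\<^sup>i\<^sup>g / (i g')\<close>, whose integral is zero, only by
  terms with the factor \<open>1 / g'\<close> or \<open>g'' / g'\<^sup>2\<close>.\<close>
lemma nonstationary_phase_bound:
  fixes F F' :: "real \<Rightarrow> complex" and g g' g'' :: "real \<Rightarrow> real"
  assumes F: "\<And>u. (F has_vector_derivative F' u) (at u)" "continuous_on UNIV F'"
    and g: "\<And>u. (g has_real_derivative g' u) (at u)"
      "\<And>u. (g' has_real_derivative g'' u) (at u)" "continuous_on UNIV g''"
    and int: "integrable lborel F" "integrable lborel F'"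
    and lim: "(F \<longlongrightarrow> 0) at_top" "(F \<longlongrightarrow> 0) at_bot"
    and l: "0 < l" "\<And>u. l \<le> \<bar>g' u\<bar>" and m: "\<And>u. \<bar>g'' u\<bar> \<le> m"
  shows "cmod (LINT u|lborel. F u * cis (g u))
           \<le> (LINT u|lborel. cmod (F' u)) / l + m * (LINT u|lborel. cmod (F u)) / l\<^sup>2"
proof -
  have g'_nz: "g' u \<noteq> 0" for u using l(2)[of u] l(1) by auto
  have m0: "0 \<le> m" using m[of 0] by linarith
  define G where "G u = F u * cis (g u) / (\<i> * of_real (g' u))" for u
  define E where "E u = (F' u / (\<i> * of_real (g' u)) - F u * of_real (g'' u) / (\<i> * of_real ((g' u)\<^sup>2))) * cis (g u)" for u
  have contF: "continuous_on UNIV F"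
    using F(1) by (meson continuous_at_imp_continuous_on has_vector_derivative_continuous)
  have contg: "continuous_on UNIV g" "continuous_on UNIV g'"
    using g by (meson DERIV_continuous continuous_at_imp_continuous_on)+
  have contE: "continuous_on UNIV E" unfolding E_def
    by (intro continuous_intros contF contg F(2) g(3)) (use g'_nz in auto)
  have contFc: "continuous_on UNIV (\<lambda>u. F u * cis (g u))"
    by (intro continuous_intros contF contg)
  have deriv: "(G has_vector_derivative (F u * cis (g u) + E u)) (at u)" for u
  proof -
    have 1: "((\<lambda>u. of_real (inverse (g' u)) :: complex) has_vector_derivative
        of_real (- (g'' u) / (g' u)\<^sup>2)) (at u)"
    proof -
      have "((\<lambda>u. inverse (g' u)) has_real_derivative (- (g'' u) / (g' u)\<^sup>2)) (at u)"
        using DERIV_inverse_fun[OF g(2) g'_nz, of u]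
        by (simp add: field_simps power2_eq_square)
      then show ?thesis
        by (metis has_real_derivative_iff_has_vector_derivative has_vector_derivative_of_real)
    qed
    have eq: "G = (\<lambda>u. - \<i> * (F u * cis (g u)) * of_real (inverse (g' u)))"
      by (auto simp: G_def fun_eq_iff divide_simps)
    show ?thesis
      unfolding eq E_def
      apply (rule has_vector_derivative_eq_rhs)
       apply (rule has_vector_derivative_mult[OF _ 1])
       apply (rule has_vector_derivative_mult_right)
       apply (rule has_vector_derivative_mult[OF F(1) has_vector_derivative_cis[OF g(1)]])
      using g'_nz[of u]
      apply (simp add: field_simps power2_eq_square)
      done
  qed
  have bnd: "cmod (E u) \<le> cmod (F' u) / l + m * cmod (F u) / l\<^sup>2" for u
  proof -
    have "cmod (E u) \<le> cmod (F' u / (\<i> * of_real (g' u))) +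
       cmod (F u * of_real (g'' u) / (\<i> * of_real ((g' u)\<^sup>2)))"
      by (simp add: E_def norm_mult norm_triangle_ineq4)
    also have "cmod (F' u / (\<i> * of_real (g' u))) = cmod (F' u) / \<bar>g' u\<bar>"
      by (simp add: norm_divide norm_mult)
    also have "\<dots> \<le> cmod (F' u) / l"
      using l by (intro divide_left_mono) (auto simp: g'_nz)
    also have "cmod (F u * of_real (g'' u) / (\<i> * of_real ((g' u)\<^sup>2)))
        = \<bar>g'' u\<bar> * cmod (F u) / \<bar>g' u\<bar>\<^sup>2"
      by (simp add: norm_divide norm_mult norm_power)
    also have "\<dots> \<le> m * cmod (F u) / l\<^sup>2"
      using l m g'_nz[of u] m0 by (intro frac_le mult_mono power_mono) auto
    finally show ?thesis by simp
  qed
  have intF: "integrable lborel (\<lambda>u. F u * cis (g u))"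
    by (rule Bochner_Integration.integrable_bound[OF int(1)])
      (use borel_measurable_continuous_onI[OF contFc] in \<open>auto simp: norm_mult\<close>)
  have intb: "integrable lborel (\<lambda>u. cmod (F' u) / l + m * cmod (F u) / l\<^sup>2)"
    using int by simp
  have intE: "integrable lborel E"
    by (rule Bochner_Integration.integrable_bound[OF intb])
      (use borel_measurable_continuous_onI[OF contE] bnd in \<open>auto intro!: AE_I2 order_trans[OF bnd abs_ge_self]\<close>)
  have limG: "(G \<longlongrightarrow> 0) L" if "(F \<longlongrightarrow> 0) L" for L
  proof (rule Lim_null_comparison)
    show "\<forall>\<^sub>F u in L. norm (G u) \<le> cmod (F u) / l"
      using l g'_nz by (intro always_eventually allI)
        (auto simp: G_def norm_divide norm_mult intro!: divide_left_mono)
    show "((\<lambda>u. cmod (F u) / l) \<longlongrightarrow> 0) L"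
      using tendsto_divide[OF tendsto_norm[OF that] tendsto_const[of l]] l by simp
  qed
  have "(LBINT u=-\<infinity>..\<infinity>. F u * cis (g u) + E u) = 0 - 0"
  proof (rule interval_integral_FTC_integrable[where F = G])
    show "set_integrable lborel (einterval (-\<infinity>) \<infinity>) (\<lambda>u. F u * cis (g u) + E u)"
      using intF intE by (simp add: set_integrable_def einterval_eq)
    show "isCont (\<lambda>u. F u * cis (g u) + E u) x" for x
      using continuous_on_add[OF contFc contE] by (simp add: continuous_on_eq_continuous_at)
  qed (use deriv limG lim in \<open>auto simp: ereal_tendsto_simps1\<close>)
  then have "(LINT u|lborel. F u * cis (g u) + E u) = 0"
    by (simp add: interval_lebesgue_integral_def einterval_eq set_lebesgue_integral_def)
  then have "(LINT u|lborel. F u * cis (g u)) = - (LINT u|lborel. E u)"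
    using intF intE by (simp add: add_eq_0_iff)
  then have "cmod (LINT u|lborel. F u * cis (g u)) = cmod (LINT u|lborel. E u)" by simp
  also have "\<dots> \<le> (LINT u|lborel. cmod (E u))" by (rule integral_norm_bound)
  also have "\<dots> \<le> (LINT u|lborel. cmod (F' u) / l + m * cmod (F u) / l\<^sup>2)"
    by (intro integral_mono integrable_norm intE intb bnd)
  also have "\<dots> = (LINT u|lborel. cmod (F' u)) / l + m * (LINT u|lborel. cmod (F u)) / l\<^sup>2"
    using int by (subst Bochner_Integration.integral_add) auto
  finally show ?thesis .
qed

section \<open>Pairing a wave packet with a single oscillation\<close>

text \<open>In the rescaled variable \<open>u = \<bar>a\<bar>\<^sup>s (t - b)\<close> the packet has unit width, and \<open>h = \<bar>a\<bar>\<^bsup>-s\<^esup>\<close> measures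
  how slowly the signal then varies. This is the wave packet transform in that variable, without its
  normalising power of \<open>\<bar>a\<bar>\<close>.\<close>
definition packet_pairing ::
  "(real \<Rightarrow> complex) \<Rightarrow> real \<Rightarrow> real \<Rightarrow> real \<Rightarrow> (real \<Rightarrow> complex) \<Rightarrow> complex" where
  "packet_pairing w h a b f =
     (LINT u|lborel. cnj (w u) * cis (- (2 * pi * h * u * a)) * f (b + h * u))"

lemma wp_transform_eq_pairing:
  assumes "1 \<le> \<bar>a\<bar>"
  shows "wp_transform w s f a b =
    of_real (\<bar>a\<bar> powr (- s / 2)) * packet_pairing w (\<bar>a\<bar> powr (- s)) a b f"
proof -
  let ?h = "\<bar>a\<bar> powr (- s)"
  have h: "\<bar>a\<bar> powr s * (?h * u) = u" for u
    using assms by (simp add: powr_minus field_simps)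
  have p: "?h * \<bar>a\<bar> powr (s / 2) = \<bar>a\<bar> powr (- s / 2)"
    using powr_add[of "\<bar>a\<bar>" "- s" "s / 2"] by (simp add: field_simps)
  have "wp_transform w s f a b = ?h *\<^sub>R
      (LINT u|lborel. cnj (wave_packet w s a b (b + ?h * u)) * f (b + ?h * u))"
    unfolding wp_transform_def using assms
    by (subst lborel_integral_real_affine[where c = ?h and t = b]) auto
  also have "(\<lambda>u. cnj (wave_packet w s a b (b + ?h * u)) * f (b + ?h * u)) =
     (\<lambda>u. of_real (\<bar>a\<bar> powr (s / 2)) *
        (cnj (w u) * cis (- (2 * pi * ?h * u * a)) * f (b + ?h * u)))"
    unfolding wave_packet_def add_diff_cancel_left' h
    by (rule ext) (simp add: cis_cnj mult_ac)
  finally show ?thesis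
    unfolding packet_pairing_def p[symmetric] by (simp add: scaleR_conv_of_real)
qed

lemma integrable_mult_bounded_continuous:
  fixes w g :: "real \<Rightarrow> complex"
  assumes "integrable lborel w" "continuous_on UNIV g" "\<And>t. cmod (g t) \<le> B"
  shows "integrable lborel (\<lambda>t. w t * g t)"
proof (rule Bochner_Integration.integrable_bound[where f = "\<lambda>t. B * cmod (w t)"])
  show "(\<lambda>t. w t * g t) \<in> borel_measurable lborel"
    using borel_measurable_continuous_onI[OF assms(2)] assms(1) by measurable
  have "cmod (w t) * cmod (g t) \<le> \<bar>B * cmod (w t)\<bar>" for t
  proof -
    have "cmod (w t) * cmod (g t) \<le> cmod (w t) * B" by (intro mult_left_mono assms) auto
    also have "\<dots> \<le> \<bar>B * cmod (w t)\<bar>" by (simp add: mult.commute)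
    finally show ?thesis .
  qed
  then show "AE t in lborel. norm (w t * g t) \<le> norm (B * cmod (w t))"
    by (auto simp: norm_mult)
qed (use assms in auto)

lemma pairing_integrable:
  assumes "integrable lborel w" "continuous_on UNIV f" "\<And>t. cmod (f t) \<le> B"
  shows "integrable lborel (\<lambda>u. cnj (w u) * cis (- (2 * pi * h * u * a)) * f (b + h * u))"
proof -
  have "integrable lborel (\<lambda>u. cnj (w u) * (cis (- (2 * pi * h * u * a)) * f (b + h * u)))"
  proof (rule integrable_mult_bounded_continuous)
    show "continuous_on UNIV (\<lambda>u. cis (- (2 * pi * h * u * a)) * f (b + h * u))"
      by (intro continuous_intros continuous_on_compose2[OF assms(2)]) auto
  qed (use assms in \<open>auto simp: norm_mult\<close>)
  then show ?thesis by (simp add: mult.assoc)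
qed

lemma pairing_norm_le:
  assumes "integrable lborel w" "continuous_on UNIV f" "\<And>t. cmod (f t) \<le> B"
  shows "cmod (packet_pairing w h a b f) \<le> B * (LINT u|lborel. cmod (w u))"
proof -
  have "cmod (packet_pairing w h a b f) \<le> (LINT u|lborel.
     cmod (cnj (w u) * cis (- (2 * pi * h * u * a)) * f (b + h * u)))"
    unfolding packet_pairing_def by (rule integral_norm_bound)
  also have "\<dots> \<le> (LINT u|lborel. B * cmod (w u))"
  proof (rule integral_mono)
    show "cmod (cnj (w u) * cis (- (2 * pi * h * u * a)) * f (b + h * u)) \<le> B * cmod (w u)" for u
      using mult_left_mono[OF assms(3)[of "b + h * u"], of "cmod (w u)"]
      by (simp add: norm_mult mult.commute)
  qed (use pairing_integrable[OF assms] assms(1) in auto)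
  finally show ?thesis by simp
qed

text \<open>The part of \<^const>\<open>gimt\<close> that survives when the shape function is replaced by one of its Fourier
  modes.\<close>
definition amplitude_phase :: "real \<Rightarrow> (real \<Rightarrow> real) \<Rightarrow> (real \<Rightarrow> real) \<Rightarrow> bool" where
  "amplitude_phase M \<alpha> \<phi> \<longleftrightarrow>
     smooth \<alpha> \<and> (\<forall>t. \<bar>deriv \<alpha> t\<bar> \<le> M \<and> 1 / M \<le> \<alpha> t \<and> \<alpha> t \<le> M) \<and>
     smooth \<phi> \<and> (\<forall>t. 1 / M \<le> \<bar>deriv \<phi> t\<bar> \<and> \<bar>deriv \<phi> t\<bar> \<le> M \<and> \<bar>deriv (deriv \<phi>) t\<bar> \<le> M)"

text \<open>The three moments that control the pairing with one oscillation: the derivative enters through integration by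
  parts, the second moment through the Taylor remainder of the phase.\<close>
definition packet_norm :: "(real \<Rightarrow> complex) \<Rightarrow> real" where
  "packet_norm w = (LINT u|lborel. cmod (w u)) + (LINT u|lborel. cmod (nth_vderiv 1 w u)) +
     (LINT u|lborel. u\<^sup>2 * cmod (w u))"

lemma packet_norm_bounds:
  shows "(LINT u|lborel. cmod (w u)) \<le> packet_norm w"
    and "(LINT u|lborel. cmod (w u)) + (LINT u|lborel. cmod (nth_vderiv 1 w u)) \<le> packet_norm w"
    and "(LINT u|lborel. cmod (w u)) + (LINT u|lborel. u\<^sup>2 * cmod (w u)) \<le> packet_norm w"
    and "0 \<le> packet_norm w"
  by (simp_all add: packet_norm_def integral_nonneg_AE)

text \<open>If \<open>\<nu> \<phi>'\<close> stays at distance \<open>L\<close> from \<open>a\<close>, the phase \<open>\<nu> \<phi>(b + h u) - h u a\<close> has derivative at least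
  \<open>h L\<close> and second derivative at most \<open>h\<^sup>2 \<bar>\<nu>\<bar> M\<close>; in \<open>g'' / g'\<^sup>2\<close> the powers of \<open>h\<close> cancel.\<close>
lemma pairing_nonstationary:
  assumes w: "schwartz w" and ap: "amplitude_phase M \<alpha> \<phi>" and M: "1 \<le> M"
    and h: "0 < h" "h \<le> 1" and L: "0 < L" "\<And>t. L \<le> \<bar>\<nu> * deriv \<phi> t - a\<bar>"
  shows "cmod (packet_pairing w h a b (\<lambda>t. of_real (\<alpha> t) * cis (2 * pi * \<nu> * \<phi> t)))
           \<le> packet_norm w * (M / (h * L) + M\<^sup>2 * \<bar>\<nu>\<bar> / L\<^sup>2)"
proof -
  note sm = smooth_real_derivatives
  have \<alpha>: "smooth \<alpha>" "\<bar>deriv \<alpha> t\<bar> \<le> M" "\<bar>\<alpha> t\<bar> \<le> M" for t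
  proof -
    have "0 \<le> 1 / M" "1 / M \<le> \<alpha> t" "\<alpha> t \<le> M" using ap M by (auto simp: amplitude_phase_def)
    then show "\<bar>\<alpha> t\<bar> \<le> M" by linarith
  qed (use ap in \<open>auto simp: amplitude_phase_def\<close>)
  have \<phi>: "smooth \<phi>" "\<bar>deriv (deriv \<phi>) t\<bar> \<le> M" for t
    using ap by (auto simp: amplitude_phase_def)
  have ws: "smooth w" using w by (simp add: schwartz_def)
  let ?w' = "nth_vderiv 1 w"
  obtain D where D: "\<And>x. cmod (w x) \<le> D / (1 + x\<^sup>2)"
    using schwartz_decay[OF w, of 0] unfolding nth_vderiv_0 by metis
  define F where "F u = cnj (w u) * of_real (\<alpha> (b + h * u))" for u
  define F' where "F' u = cnj (w u) * of_real (deriv \<alpha> (b + h * u) * h) +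
    cnj (?w' u) * of_real (\<alpha> (b + h * u))" for u
  define g where "g u = 2 * pi * (\<nu> * \<phi> (b + h * u) - h * u * a)" for u
  define g' where "g' u = 2 * pi * (\<nu> * (deriv \<phi> (b + h * u) * h) - h * a)" for u
  define g'' where "g'' u = 2 * pi * (\<nu> * (deriv (deriv \<phi>) (b + h * u) * h * h))" for u
  have chain: "((\<lambda>u. p (b + h * u)) has_real_derivative p' (b + h * u) * h) (at u)"
    if "\<And>x. (p has_real_derivative p' x) (at x)" for p p' :: "real \<Rightarrow> real" and u
    by (rule DERIV_chain2[OF that]) (auto intro!: derivative_eq_intros)
  have Fd: "(F has_vector_derivative F' u) (at u)" for u
  proof -
    have 1: "((\<lambda>u. cnj (w u)) has_vector_derivative cnj (?w' u)) (at u)"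
      using has_vector_derivative_cnj[OF smooth_has_vector_derivative[OF ws, of 0]] by simp
    have 2: "((\<lambda>u. of_real (\<alpha> (b + h * u)) :: complex) has_vector_derivative
      of_real (deriv \<alpha> (b + h * u) * h)) (at u)"
      by (rule has_vector_derivative_of_real)
        (use chain[OF sm(1)[OF \<alpha>(1)]] in \<open>simp add: has_real_derivative_iff_has_vector_derivative\<close>)
    show ?thesis unfolding F_def F'_def by (rule has_vector_derivative_mult[OF 1 2])
  qed
  have cw: "continuous_on UNIV w" "continuous_on UNIV ?w'"
    using smooth_continuous[OF ws, of 0] smooth_continuous[OF ws, of 1] by auto
  have contF: "continuous_on UNIV F" unfolding F_def
    by (intro continuous_intros cw continuous_on_compose2[OF sm(3)[OF \<alpha>(1)]]) auto
  have contF': "continuous_on UNIV F'" unfolding F'_def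
    by (intro continuous_intros cw continuous_on_compose2[OF sm(3)[OF \<alpha>(1)]]
        continuous_on_compose2[OF sm(4)[OF \<alpha>(1)]]) auto
  have gd: "(g has_real_derivative g' u) (at u)" for u
    unfolding g_def g'_def
    by (auto intro!: derivative_eq_intros chain[OF sm(1)[OF \<phi>(1)]])
  have gd': "(g' has_real_derivative g'' u) (at u)" for u
    unfolding g'_def g''_def
    by (auto intro!: derivative_eq_intros chain[OF sm(2)[OF \<phi>(1)]])
  have contg'': "continuous_on UNIV g''" unfolding g''_def
    by (intro continuous_intros continuous_on_compose2[OF sm(5)[OF \<phi>(1)]]) auto
  have iw: "integrable lborel w" "integrable lborel ?w'"
    using schwartz_integrable[OF w, of 0] schwartz_integrable[OF w, of 1] by auto
  have bF: "cmod (F u) \<le> M * cmod (w u)" for u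
    using mult_left_mono[OF \<alpha>(3)[of "b + h * u"], of "cmod (w u)"]
    by (simp add: F_def norm_mult mult.commute)
  have bF': "cmod (F' u) \<le> M * cmod (w u) + M * cmod (?w' u)" for u
  proof -
    have "cmod (F' u) \<le> cmod (w u) * (\<bar>deriv \<alpha> (b + h * u)\<bar> * \<bar>h\<bar>) + cmod (?w' u) * \<bar>\<alpha> (b + h * u)\<bar>"
      unfolding F'_def by (rule order_trans[OF norm_triangle_ineq]) (simp add: norm_mult)
    also have "\<dots> \<le> cmod (w u) * (M * 1) + cmod (?w' u) * M"
      using h \<alpha> M by (intro add_mono mult_mono) auto
    finally show ?thesis by (simp add: algebra_simps)
  qed
  have iM: "integrable lborel (\<lambda>u. M * cmod (w u))"
    "integrable lborel (\<lambda>u. M * cmod (w u) + M * cmod (?w' u))" using iw by auto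
  have iF: "integrable lborel F"
    by (rule Bochner_Integration.integrable_bound[OF iM(1)])
      (use borel_measurable_continuous_onI[OF contF] bF in
        \<open>auto intro!: AE_I2 order_trans[OF bF abs_ge_self]\<close>)
  have iF': "integrable lborel F'"
    by (rule Bochner_Integration.integrable_bound[OF iM(2)])
      (use borel_measurable_continuous_onI[OF contF'] in
        \<open>auto simp del: One_nat_def intro!: AE_I2 order_trans[OF bF' abs_ge_self]\<close>)
  have decF: "cmod (F u) \<le> (M * D) / (1 + u\<^sup>2)" for u
    using order_trans[OF bF mult_left_mono[OF D, of M]] M by simp
  let ?l = "2 * pi * (h * L)" and ?m = "2 * pi * (\<bar>\<nu>\<bar> * M * h\<^sup>2)"
  have l: "0 < ?l" using h L by simp
  have gl: "?l \<le> \<bar>g' u\<bar>" for u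
  proof -
    have "g' u = 2 * pi * (h * (\<nu> * deriv \<phi> (b + h * u) - a))"
      by (simp add: g'_def algebra_simps)
    then have "\<bar>g' u\<bar> = 2 * pi * (h * \<bar>\<nu> * deriv \<phi> (b + h * u) - a\<bar>)"
      using h by (simp add: abs_mult)
    then show ?thesis using L(2)[of "b + h * u"] h by (simp add: mult_left_mono)
  qed
  have gm: "\<bar>g'' u\<bar> \<le> ?m" for u
  proof -
    have "\<bar>g'' u\<bar> = 2 * pi * (\<bar>\<nu>\<bar> * \<bar>deriv (deriv \<phi>) (b + h * u)\<bar> * h\<^sup>2)"
      using h by (simp add: g''_def abs_mult power2_eq_square)
    then show ?thesis using \<phi>(2)[of "b + h * u"] by (auto intro!: mult_left_mono mult_right_mono)
  qed
  have "packet_pairing w h a b (\<lambda>t. of_real (\<alpha> t) * cis (2 * pi * \<nu> * \<phi> t)) =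
    (LINT u|lborel. F u * cis (g u))"
    unfolding packet_pairing_def F_def g_def
  proof (intro Bochner_Integration.integral_cong refl)
    fix u
    have "cis (2 * pi * (\<nu> * \<phi> (b + h * u) - h * u * a)) =
      cis (- (2 * pi * h * u * a)) * cis (2 * pi * \<nu> * \<phi> (b + h * u))"
      unfolding cis_mult by (simp add: algebra_simps)
    then show "cnj (w u) * cis (- (2 * pi * h * u * a)) *
        (of_real (\<alpha> (b + h * u)) * cis (2 * pi * \<nu> * \<phi> (b + h * u))) =
      cnj (w u) * of_real (\<alpha> (b + h * u)) * cis (2 * pi * (\<nu> * \<phi> (b + h * u) - h * u * a))"
      by (simp only: mult_ac)
  qed
  also have "cmod \<dots> \<le> (LINT u|lborel. cmod (F' u)) / ?l + ?m * (LINT u|lborel. cmod (F u)) / ?l\<^sup>2"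
    by (rule nonstationary_phase_bound[OF Fd contF' gd gd' contg'' iF iF'
          tendsto_0_of_quadratic_decay[OF decF] l gl gm])
  also have "\<dots> \<le> (M * packet_norm w) / (h * L) + ?m * (M * packet_norm w) / ?l\<^sup>2"
  proof (intro add_mono)
    have "(LINT u|lborel. cmod (F' u)) \<le> (LINT u|lborel. M * cmod (w u) + M * cmod (?w' u))"
      by (intro integral_mono integrable_norm iF' iM bF')
    also have "\<dots> = M * ((LINT u|lborel. cmod (w u)) + (LINT u|lborel. cmod (?w' u)))"
      using iw by (simp add: algebra_simps)
    also have "\<dots> \<le> M * packet_norm w"
      using packet_norm_bounds(2)[of w] M by (intro mult_left_mono) auto
    finally have "(LINT u|lborel. cmod (F' u)) \<le> M * packet_norm w" .
    moreover have "h * L \<le> ?l" using pi_gt3 mult_pos_pos[OF h(1) L(1)] by (simp add: mult_le_cancel_right1)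
    ultimately show "(LINT u|lborel. cmod (F' u)) / ?l \<le> (M * packet_norm w) / (h * L)"
      using h L M packet_norm_bounds(4)[of w] by (intro frac_le) auto
    have "(LINT u|lborel. cmod (F u)) \<le> (LINT u|lborel. M * cmod (w u))"
      by (intro integral_mono integrable_norm iF iM bF)
    also have "\<dots> \<le> M * packet_norm w"
      using packet_norm_bounds(1)[of w] M by simp
    finally show "?m * (LINT u|lborel. cmod (F u)) / ?l\<^sup>2 \<le> ?m * (M * packet_norm w) / ?l\<^sup>2"
      using M by (intro divide_right_mono mult_left_mono) auto
  qed
  also have "?m * (M * packet_norm w) / ?l\<^sup>2 = (packet_norm w * (M\<^sup>2 * \<bar>\<nu>\<bar> / L\<^sup>2)) / (2 * pi)"
    using h L by (simp add: divide_simps power_mult_distrib) (simp add: power2_eq_square)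
  also have "\<dots> \<le> (packet_norm w * (M\<^sup>2 * \<bar>\<nu>\<bar> / L\<^sup>2)) / 1"
    using pi_gt3 packet_norm_bounds(4)[of w] by (intro divide_left_mono) auto
  finally show ?thesis by (simp add: algebra_simps)
qed

lemma cmod_cis_diff_le: "cmod (cis x - cis y) \<le> \<bar>x - y\<bar>"
proof -
  have "norm (cis x - cis y) \<le> 1 * norm (x - y)"
  proof (rule differentiable_bound[where S = UNIV and f' = "\<lambda>x t. t *\<^sub>R (\<i> * cis x)"])
    show "(cis has_derivative (\<lambda>t. t *\<^sub>R (\<i> * cis x))) (at x within UNIV)" for x
      using has_derivative_cis[of "\<lambda>x. x" "\<lambda>t. t" x UNIV] by simp
    show "onorm (\<lambda>t. t *\<^sub>R (\<i> * cis x)) \<le> 1" for x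
      by (rule onorm_le) (simp add: norm_mult)
  qed auto
  then show ?thesis by simp
qed

lemma real_increment_bound:
  fixes f f' :: "real \<Rightarrow> real"
  assumes "\<And>x. (f has_real_derivative f' x) (at x)" "\<And>x. \<bar>f' x\<bar> \<le> B"
  shows "\<bar>f y - f x\<bar> \<le> B * \<bar>y - x\<bar>"
  using field_differentiable_bound[of UNIV f f' B y x] assms by simp

lemma real_linearization_bound:
  fixes f f' f'' :: "real \<Rightarrow> real"
  assumes f: "\<And>x. (f has_real_derivative f' x) (at x)" "\<And>x. (f' has_real_derivative f'' x) (at x)"
    and B: "\<And>x. \<bar>f'' x\<bar> \<le> B"
  shows "\<bar>f y - f x - (y - x) * f' x\<bar> \<le> B * (y - x)\<^sup>2"
proof -
  have B0: "0 \<le> B" using B[of 0] by linarith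
  have "norm (f y - f x - (y - x) *\<^sub>R f' x) \<le> norm (y - x) * (B * \<bar>y - x\<bar>)"
  proof (rule vector_differentiable_bound_linearization[where S = "closed_segment x y" and f' = f'])
    show "(f has_vector_derivative f' z) (at z within closed_segment x y)" for z
      using f(1)[of z] by (simp add: has_real_derivative_iff_has_vector_derivative
          has_vector_derivative_at_within)
    show "norm (f' z - f' x) \<le> B * \<bar>y - x\<bar>" if "z \<in> closed_segment x y" for z
    proof -
      have "\<bar>f' z - f' x\<bar> \<le> B * \<bar>z - x\<bar>" by (rule real_increment_bound[OF f(2) B])
      also have "\<dots> \<le> B * \<bar>y - x\<bar>"
        using that B0 by (intro mult_left_mono) (auto simp: closed_segment_eq_real_ivl split: if_splits)
      finally show ?thesis by simp
    qed
  qed auto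
  then show ?thesis by (simp add: power2_eq_square abs_mult ac_simps abs_mult_self_eq)
qed

text \<open>Freezing the amplitude and linearising the phase at \<open>b\<close> turns the pairing into a value of the
  Fourier transform of \<open>w\<close>, which is zero by hypothesis, so only the two Taylor remainders are left. They
  carry \<open>h\<close> and \<open>\<bar>\<nu>\<bar> h\<^sup>2\<close>; for \<open>h = \<bar>a\<bar>\<^bsup>-s\<^esup>\<close> with \<open>s > 1/2\<close> the latter is small as long as \<open>\<bar>\<nu>\<bar>\<close> is at
  most comparable to \<open>\<bar>a\<bar>\<close>.\<close>
lemma pairing_off_band:
  assumes w: "schwartz w" and ap: "amplitude_phase M \<alpha> \<phi>" and M: "1 \<le> M"
    and h: "0 < h" "h \<le> 1" and zero: "fourier w (- (h * (a - \<nu> * deriv \<phi> b))) = 0"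
  shows "cmod (packet_pairing w h a b (\<lambda>t. of_real (\<alpha> t) * cis (2 * pi * \<nu> * \<phi> t)))
           \<le> packet_norm w * (M * h + 7 * M\<^sup>2 * \<bar>\<nu>\<bar> * h\<^sup>2)"
proof -
  note sm = smooth_real_derivatives
  have \<alpha>: "smooth \<alpha>" "\<bar>deriv \<alpha> t\<bar> \<le> M" "\<bar>\<alpha> t\<bar> \<le> M" for t
  proof -
    have "0 \<le> 1 / M" "1 / M \<le> \<alpha> t" "\<alpha> t \<le> M" using ap M by (auto simp: amplitude_phase_def)
    then show "\<bar>\<alpha> t\<bar> \<le> M" by linarith
  qed (use ap in \<open>auto simp: amplitude_phase_def\<close>)
  have \<phi>: "smooth \<phi>" "\<bar>deriv (deriv \<phi>) t\<bar> \<le> M" for t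
    using ap by (auto simp: amplitude_phase_def)
  define f where "f t = of_real (\<alpha> t) * cis (2 * pi * \<nu> * \<phi> t)" for t
  define f0 where "f0 t = of_real (\<alpha> b) * cis (2 * pi * \<nu> * (\<phi> b + (t - b) * deriv \<phi> b))" for t
  have iw: "integrable lborel w" using schwartz_integrable[OF w, of 0] by simp
  have iw2: "integrable lborel (\<lambda>u. u\<^sup>2 * cmod (w u))" using schwartz_integrable[OF w, of 0] by simp
  have cf: "continuous_on UNIV f" unfolding f_def
    by (intro continuous_intros sm(3) \<alpha> \<phi>)
  have cf0: "continuous_on UNIV f0" unfolding f0_def
    by (intro continuous_intros)
  have bf: "cmod (f t) \<le> M" "cmod (f0 t) \<le> M" for t
    using \<alpha>(3)[of t] \<alpha>(3)[of b] by (simp_all add: f_def f0_def norm_mult)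
  have zero': "packet_pairing w h a b f0 = 0"
  proof -
    let ?\<xi> = "- (h * (a - \<nu> * deriv \<phi> b))"
    have "packet_pairing w h a b f0 = (LINT u|lborel. of_real (\<alpha> b) * cis (2 * pi * \<nu> * \<phi> b) *
        cnj (w u * cis (- 2 * pi * u * ?\<xi>)))"
      unfolding packet_pairing_def f0_def
    proof (rule Bochner_Integration.integral_cong[OF refl])
      fix u
      define A where "A = - (2 * pi * h * u * a)"
      define B where "B = 2 * pi * \<nu> * (\<phi> b + (b + h * u - b) * deriv \<phi> b)"
      define C where "C = 2 * pi * \<nu> * \<phi> b"
      define E where "E = - 2 * pi * u * ?\<xi>"
      have "A + B = C + - E"
        by (simp add: A_def B_def C_def E_def algebra_simps)
      then have eq: "cis A * cis B = cis C * cnj (cis E)"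
        by (simp only: cis_mult cis_cnj)
      have "cnj (w u) * cis A * (of_real (\<alpha> b) * cis B) = cnj (w u) * of_real (\<alpha> b) * (cis A * cis B)"
        by (simp only: mult_ac)
      also have "\<dots> = of_real (\<alpha> b) * cis C * cnj (w u * cis E)"
        unfolding eq complex_cnj_mult by (simp only: mult_ac)
      finally show "cnj (w u) * cis (- (2 * pi * h * u * a)) *
          (of_real (\<alpha> b) * cis (2 * pi * \<nu> * (\<phi> b + (b + h * u - b) * deriv \<phi> b))) =
         of_real (\<alpha> b) * cis (2 * pi * \<nu> * \<phi> b) * cnj (w u * cis (- 2 * pi * u * ?\<xi>))"
        by (simp only: A_def B_def C_def E_def)
    qed
    also have "\<dots> = of_real (\<alpha> b) * cis (2 * pi * \<nu> * \<phi> b) * cnj (fourier w ?\<xi>)"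
      unfolding fourier_def by (simp only: integral_mult_right_zero Bochner_Integration.integral_cnj)
    finally show ?thesis using zero by simp
  qed
  have diff: "cmod (f (b + h * u) - f0 (b + h * u)) \<le> (M * h + 7 * M\<^sup>2 * \<bar>\<nu>\<bar> * h\<^sup>2) * (1 + u\<^sup>2)" for u
  proof -
    let ?t = "b + h * u"
    let ?p = "2 * pi * \<nu> * \<phi> ?t" and ?q = "2 * pi * \<nu> * (\<phi> b + (?t - b) * deriv \<phi> b)"
    have "f ?t - f0 ?t = of_real (\<alpha> ?t - \<alpha> b) * cis ?p + of_real (\<alpha> b) * (cis ?p - cis ?q)"
      by (simp add: f_def f0_def algebra_simps)
    also have "cmod \<dots> \<le> \<bar>\<alpha> ?t - \<alpha> b\<bar> + \<bar>\<alpha> b\<bar> * cmod (cis ?p - cis ?q)"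
      by (rule order_trans[OF norm_triangle_ineq]) (simp add: norm_mult flip: of_real_diff)
    also have "\<dots> \<le> M * \<bar>?t - b\<bar> + M * \<bar>?p - ?q\<bar>"
      using real_increment_bound[OF sm(1)[OF \<alpha>(1)] \<alpha>(2), of b ?t] \<alpha>(3)[of b] M
      by (intro add_mono mult_mono cmod_cis_diff_le) auto
    also have "\<bar>?p - ?q\<bar> = 2 * pi * \<bar>\<nu>\<bar> * \<bar>\<phi> ?t - \<phi> b - (?t - b) * deriv \<phi> b\<bar>"
    proof -
      have "?p - ?q = 2 * pi * \<nu> * (\<phi> ?t - \<phi> b - (?t - b) * deriv \<phi> b)"
        by (simp add: algebra_simps)
      then show ?thesis by (simp add: abs_mult)
    qed
    also have "\<dots> \<le> 7 * \<bar>\<nu>\<bar> * (M * (?t - b)\<^sup>2)"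
    proof (intro mult_mono)
      show "2 * pi \<le> 7" using pi_approx by simp
      show "\<bar>\<phi> ?t - \<phi> b - (?t - b) * deriv \<phi> b\<bar> \<le> M * (?t - b)\<^sup>2"
        by (rule real_linearization_bound[OF sm(1,2)[OF \<phi>(1)] \<phi>(2)])
    qed auto
    finally have "cmod (f ?t - f0 ?t) \<le> M * \<bar>?t - b\<bar> + M * (7 * \<bar>\<nu>\<bar> * (M * (?t - b)\<^sup>2))"
      using M by simp
    also have "\<dots> = M * h * \<bar>u\<bar> + 7 * M\<^sup>2 * \<bar>\<nu>\<bar> * h\<^sup>2 * u\<^sup>2"
      using h by (simp add: abs_mult power_mult_distrib power2_eq_square)
    also have "\<dots> \<le> M * h * (1 + u\<^sup>2) + 7 * M\<^sup>2 * \<bar>\<nu>\<bar> * h\<^sup>2 * (1 + u\<^sup>2)"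
    proof (intro add_mono mult_left_mono)
      have "0 \<le> (\<bar>u\<bar> - 1)\<^sup>2" by simp
      then have "2 * \<bar>u\<bar> \<le> 1 + u\<^sup>2" by (simp add: power2_diff)
      then show "\<bar>u\<bar> \<le> 1 + u\<^sup>2" by linarith
    qed (use M h in auto)
    finally show ?thesis by (simp add: algebra_simps)
  qed
  let ?K = "M * h + 7 * M\<^sup>2 * \<bar>\<nu>\<bar> * h\<^sup>2"
  have K0: "0 \<le> ?K" using M h by simp
  define p where "p u = cnj (w u) * cis (- (2 * pi * h * u * a)) * f (b + h * u)" for u
  define p0 where "p0 u = cnj (w u) * cis (- (2 * pi * h * u * a)) * f0 (b + h * u)" for u
  have int: "integrable lborel p" "integrable lborel p0"
    unfolding p_def p0_def
    by (rule pairing_integrable[OF iw cf bf(1)], rule pairing_integrable[OF iw cf0 bf(2)])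
  have "packet_pairing w h a b f = packet_pairing w h a b f - packet_pairing w h a b f0"
    using zero' by simp
  also have "\<dots> = (LINT u|lborel. p u - p0 u)"
    unfolding Bochner_Integration.integral_diff[OF int]
    by (simp only: packet_pairing_def p_def[abs_def] p0_def[abs_def])
  also have "cmod \<dots> \<le> (LINT u|lborel. cmod (p u - p0 u))"
    by (rule integral_norm_bound)
  also have "\<dots> \<le> (LINT u|lborel. ?K * (cmod (w u) + u\<^sup>2 * cmod (w u)))"
  proof (rule integral_mono)
    show "cmod (p u - p0 u) \<le> ?K * (cmod (w u) + u\<^sup>2 * cmod (w u))" for u
    proof -
      have "p u - p0 u = cnj (w u) * cis (- (2 * pi * h * u * a)) * (f (b + h * u) - f0 (b + h * u))"
        by (simp only: p_def p0_def right_diff_distrib)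
      then have "cmod (p u - p0 u) = cmod (w u) * cmod (f (b + h * u) - f0 (b + h * u))"
        by (simp add: norm_mult)
      also have "\<dots> \<le> cmod (w u) * (?K * (1 + u\<^sup>2))"
        by (intro mult_left_mono diff) simp
      finally show ?thesis by (simp only: algebra_simps mult_1_left mult_1_right)
    qed
  qed (use int iw iw2 in auto)
  also have "\<dots> = ?K * ((LINT u|lborel. cmod (w u)) + (LINT u|lborel. u\<^sup>2 * cmod (w u)))"
    using iw iw2 by simp
  also have "\<dots> \<le> ?K * packet_norm w"
    by (intro mult_left_mono packet_norm_bounds K0)
  finally show ?thesis by (simp add: f_def[abs_def] mult.commute)
qed

text \<open>Two regimes cover all frequencies. If \<open>\<bar>a\<bar>\<close> and \<open>\<bar>\<nu>\<bar>\<close> are comparable, the linearised phase gives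
  the bound, with \<open>\<bar>\<nu>\<bar> \<bar>a\<bar>\<^bsup>-2s\<^esup> \<le> 2 M \<bar>a\<bar>\<^bsup>1-2s\<^esup>\<close>. Otherwise \<open>\<nu> \<phi>' - a\<close> is at least a fixed
  multiple \<open>L\<close> of the larger of the two, and integration by parts gains \<open>\<bar>a\<bar>\<^sup>s / L\<close>, at most a multiple of \<open>L\<^bsup>s-1\<^esup>\<close>.\<close>
lemma pairing_oscillation_bound:
  assumes w: "schwartz w" "\<And>\<xi>. d \<le> \<bar>\<xi>\<bar> \<Longrightarrow> fourier w \<xi> = 0"
    and ap: "amplitude_phase M \<alpha> \<phi>" and M: "1 \<le> M" and s: "1 / 2 < s" "s < 1"
    and a: "1 \<le> \<bar>a\<bar>" and X: "1 \<le> X" "2 * M * X \<le> \<bar>\<nu>\<bar>"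
    and off: "d \<le> \<bar>a\<bar> powr (- s) * \<bar>a - \<nu> * deriv \<phi> b\<bar>"
  shows "cmod (packet_pairing w (\<bar>a\<bar> powr (- s)) a b (\<lambda>t. of_real (\<alpha> t) * cis (2 * pi * \<nu> * \<phi> t)))
           \<le> packet_norm w * (14 * M ^ 3 * (X powr (s - 1) + X powr (1 - 2 * s)))"
proof -
  let ?h = "\<bar>a\<bar> powr (- s)"
  let ?\<eta> = "X powr (s - 1) + X powr (1 - 2 * s)"
  have h: "0 < ?h" "?h \<le> 1"
    using a s powr_mono[of "- s" 0 "\<bar>a\<bar>"] by (auto split: if_splits)
  have Mp: "M \<le> M ^ 3" "M\<^sup>2 \<le> M ^ 3"
    using M power_increasing[of 1 3 M] power_increasing[of 2 3 M] by auto
  have d\<phi>: "1 / M \<le> \<bar>deriv \<phi> t\<bar>" "\<bar>deriv \<phi> t\<bar> \<le> M" for t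
    using ap by (auto simp: amplitude_phase_def)
  have pX: "0 \<le> X powr (s - 1)" "0 \<le> X powr (1 - 2 * s)" by auto
  have \<nu>X: "X \<le> \<bar>\<nu>\<bar> / (2 * M)" using X M by (simp add: field_simps)
  show ?thesis
  proof (cases "\<bar>\<nu>\<bar> / (2 * M) < \<bar>a\<bar> \<and> \<bar>a\<bar> < 2 * M * \<bar>\<nu>\<bar>")
    case True
    have aX: "X \<le> \<bar>a\<bar>" using True \<nu>X by linarith
    have "fourier w (- (?h * (a - \<nu> * deriv \<phi> b))) = 0"
      using off by (intro w(2)) (simp add: abs_mult)
    from pairing_off_band[OF w(1) ap M h this]
    have "cmod (packet_pairing w ?h a b (\<lambda>t. of_real (\<alpha> t) * cis (2 * pi * \<nu> * \<phi> t)))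
           \<le> packet_norm w * (M * ?h + 7 * M\<^sup>2 * \<bar>\<nu>\<bar> * ?h\<^sup>2)" .
    also have "\<dots> \<le> packet_norm w * (14 * M ^ 3 * ?\<eta>)"
    proof (intro mult_left_mono packet_norm_bounds)
      have "?h \<le> X powr (- s)"
        using aX X s by (intro powr_mono2') auto
      also have "\<dots> \<le> X powr (s - 1)" using X s by (intro powr_mono) auto
      finally have 1: "M * ?h \<le> M ^ 3 * X powr (s - 1)" using M Mp by (intro mult_mono) auto
      have "\<bar>\<nu>\<bar> * ?h\<^sup>2 \<le> 2 * M * \<bar>a\<bar> * ?h\<^sup>2"
        using True M by (intro mult_right_mono) (auto simp: field_simps)
      also have "\<dots> = 2 * M * \<bar>a\<bar> powr (1 - 2 * s)"
      proof -
        have "\<bar>a\<bar> * ?h\<^sup>2 = \<bar>a\<bar> powr 1 * (?h * ?h)" using a by (simp add: power2_eq_square)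
        also have "\<dots> = \<bar>a\<bar> powr (1 - 2 * s)"
          by (simp only: powr_add[symmetric]) (simp add: algebra_simps)
        finally show ?thesis by (simp add: mult.assoc)
      qed
      also have "\<dots> \<le> 2 * M * X powr (1 - 2 * s)"
        using aX X s M by (intro mult_left_mono powr_mono2') auto
      finally have "7 * M\<^sup>2 * (\<bar>\<nu>\<bar> * ?h\<^sup>2) \<le> 7 * M\<^sup>2 * (2 * M * X powr (1 - 2 * s))"
        using M by (intro mult_left_mono) auto
      also have "\<dots> = 14 * M ^ 3 * X powr (1 - 2 * s)"
        by (simp add: power2_eq_square power3_eq_cube)
      finally have 2: "7 * M\<^sup>2 * \<bar>\<nu>\<bar> * ?h\<^sup>2 \<le> 14 * M ^ 3 * X powr (1 - 2 * s)" by (simp add: mult.assoc)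
      have "M ^ 3 * X powr (s - 1) \<le> 14 * M ^ 3 * X powr (s - 1)"
        using M pX by (intro mult_right_mono) auto
      then show "M * ?h + 7 * M\<^sup>2 * \<bar>\<nu>\<bar> * ?h\<^sup>2 \<le> 14 * M ^ 3 * ?\<eta>"
        using 1 2 by (simp only: distrib_left)
    qed
    finally show ?thesis .
  next
    case False
    \<comment> \<open>The larger of the two frequencies, up to the factors that make it a lower bound in both cases.\<close>
    define L where "L = max (\<bar>a\<bar> / 2) (\<bar>\<nu>\<bar> / (2 * M))"
    have LX: "X \<le> L" "0 < L" using \<nu>X X(1) by (auto simp: L_def)
    have gap: "L \<le> \<bar>\<nu> * deriv \<phi> t - a\<bar>" for t
    proof -
      have up: "\<bar>\<nu> * deriv \<phi> t\<bar> \<le> M * \<bar>\<nu>\<bar>"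
        using mult_left_mono[OF d\<phi>(2)[of t], of "\<bar>\<nu>\<bar>"] by (simp add: abs_mult mult.commute)
      have lo: "\<bar>\<nu>\<bar> / M \<le> \<bar>\<nu> * deriv \<phi> t\<bar>"
        using mult_left_mono[OF d\<phi>(1)[of t], of "\<bar>\<nu>\<bar>"] by (simp add: abs_mult)
      have half: "\<bar>\<nu>\<bar> / M = \<bar>\<nu>\<bar> / (2 * M) + \<bar>\<nu>\<bar> / (2 * M)" using M by (simp add: field_simps)
      show ?thesis
      proof (cases "\<bar>a\<bar> \<le> \<bar>\<nu>\<bar> / (2 * M)")
        case True
        then have "L = \<bar>\<nu>\<bar> / (2 * M)" by (auto simp: L_def)
        with True lo half show ?thesis by linarith
      next
        case False
        then have large: "2 * M * \<bar>\<nu>\<bar> \<le> \<bar>a\<bar>"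
          using \<open>\<not> (\<bar>\<nu>\<bar> / (2 * M) < \<bar>a\<bar> \<and> \<bar>a\<bar> < 2 * M * \<bar>\<nu>\<bar>)\<close> by auto
        have "\<bar>\<nu>\<bar> / (2 * M) \<le> \<bar>\<nu>\<bar>"
          using M mult_right_mono[of 1 "2 * M" "\<bar>\<nu>\<bar>"] by (simp add: field_simps)
        also have "\<dots> \<le> M * \<bar>\<nu>\<bar>" using M by (simp add: mult_le_cancel_right1)
        finally have "L = \<bar>a\<bar> / 2" using large by (simp add: L_def)
        with up large show ?thesis by linarith
      qed
    qed
    have hL: "1 / (?h * L) \<le> 2 * X powr (s - 1)"
    proof -
      have "(2 * L) powr (- s) \<le> ?h"
        using a s by (intro powr_mono2') (auto simp: L_def)
      then have "(2 * L) powr (- s) * (2 * L) \<le> ?h * (2 * L)"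
        using LX by (intro mult_right_mono) auto
      also have "(2 * L) powr (- s) * (2 * L) = (2 * L) powr (- s) * (2 * L) powr 1"
        using LX by simp
      also have "\<dots> = (2 * L) powr (1 - s)"
        by (simp only: powr_add[symmetric]) (simp add: algebra_simps)
      finally have "(2 * L) powr (1 - s) \<le> 2 * (?h * L)" by simp
      moreover have "X powr (1 - s) \<le> (2 * L) powr (1 - s)"
        using LX X s by (intro powr_mono2) auto
      ultimately have "X powr (1 - s) / 2 \<le> ?h * L" by linarith
      then have "1 / (?h * L) \<le> 1 / (X powr (1 - s) / 2)"
        using X h LX by (intro divide_left_mono mult_pos_pos) auto
      also have "\<dots> = 2 * X powr (s - 1)"
        using powr_minus_divide[of X "1 - s"] by simp
      finally show ?thesis .
    qed
    have \<nu>L: "\<bar>\<nu>\<bar> / L\<^sup>2 \<le> 2 * M * X powr (s - 1)"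
    proof -
      have "\<bar>\<nu>\<bar> \<le> 2 * M * L" using M by (simp add: L_def field_simps max_def)
      then have "\<bar>\<nu>\<bar> / L\<^sup>2 \<le> 2 * M * L / L\<^sup>2" by (intro divide_right_mono) auto
      also have "\<dots> = 2 * M / L" using LX by (simp add: power2_eq_square)
      also have "\<dots> \<le> 2 * M / X" using LX X M by (intro divide_left_mono) auto
      also have "\<dots> = 2 * M * X powr (- 1)" using X by (simp add: powr_minus_divide)
      also have "\<dots> \<le> 2 * M * X powr (s - 1)" using X M s by (intro mult_left_mono powr_mono) auto
      finally show ?thesis .
    qed
    from pairing_nonstationary[OF w(1) ap M h LX(2) gap]
    have "cmod (packet_pairing w ?h a b (\<lambda>t. of_real (\<alpha> t) * cis (2 * pi * \<nu> * \<phi> t)))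
           \<le> packet_norm w * (M / (?h * L) + M\<^sup>2 * \<bar>\<nu>\<bar> / L\<^sup>2)" .
    also have "\<dots> \<le> packet_norm w * (14 * M ^ 3 * ?\<eta>)"
    proof (intro mult_left_mono packet_norm_bounds)
      have "M / (?h * L) \<le> M * (2 * X powr (s - 1))"
        using mult_left_mono[OF hL, of M] M by simp
      also have "\<dots> \<le> M ^ 3 * (2 * X powr (s - 1))" using Mp by (intro mult_right_mono) auto
      finally have 1: "M / (?h * L) \<le> 2 * (M ^ 3 * X powr (s - 1))" by simp
      have "M\<^sup>2 * \<bar>\<nu>\<bar> / L\<^sup>2 \<le> M\<^sup>2 * (2 * M * X powr (s - 1))"
        using mult_left_mono[OF \<nu>L, of "M\<^sup>2"] by simp
      then have 2: "M\<^sup>2 * \<bar>\<nu>\<bar> / L\<^sup>2 \<le> 2 * (M ^ 3 * X powr (s - 1))"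
        by (simp add: power2_eq_square power3_eq_cube mult_ac)
      have 3: "0 \<le> M ^ 3 * X powr (s - 1)" "0 \<le> M ^ 3 * X powr (1 - 2 * s)"
        using M by auto
      show "M / (?h * L) + M\<^sup>2 * \<bar>\<nu>\<bar> / L\<^sup>2 \<le> 14 * M ^ 3 * ?\<eta>"
        using 1 2 3 by (simp only: distrib_left mult.assoc)
    qed
    finally show ?thesis .
  qed
qed

section \<open>Summing over the Fourier series\<close>

lemma shape_function_series:
  assumes "\<sigma> \<in> shape_functions M"
  shows "continuous_on UNIV \<sigma>" "fourier_coeff \<sigma> 0 = 0"
    and "\<And>m::nat. (\<Sum>n\<in>{- int m..int m}. cmod (fourier_coeff \<sigma> n)) \<le> M"
    and "uniform_limit UNIV
       (\<lambda>m t. \<Sum>n\<in>{- int m..int m}. fourier_coeff \<sigma> n * cis (of_int n * t)) \<sigma> sequentially"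
    and "\<And>t. cmod (\<sigma> t) \<le> M"
proof -
  show "continuous_on UNIV \<sigma>" "fourier_coeff \<sigma> 0 = 0"
    and lim: "uniform_limit UNIV
       (\<lambda>m t. \<Sum>n\<in>{- int m..int m}. fourier_coeff \<sigma> n * cis (of_int n * t)) \<sigma> sequentially"
    using assms by (auto simp: shape_functions_def wiener_algebra_def)
  show part: "(\<Sum>n\<in>{- int m..int m}. cmod (fourier_coeff \<sigma> n)) \<le> M" for m :: nat
  proof -
    have "(\<Sum>n\<in>{- int m..int m}. cmod (fourier_coeff \<sigma> n)) \<le> (\<Sum>\<^sub>\<infinity>n. cmod (fourier_coeff \<sigma> n))"
      using assms by (intro finite_sum_le_infsum) (auto simp: shape_functions_def wiener_algebra_def)
    also have "\<dots> \<le> M" using assms by (auto simp: shape_functions_def)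
    finally show ?thesis .
  qed
  show "cmod (\<sigma> t) \<le> M" for t
  proof (rule LIMSEQ_le_const2)
    show "(\<lambda>m. cmod (\<Sum>n\<in>{- int m..int m}. fourier_coeff \<sigma> n * cis (of_int n * t)))
        \<longlonglongrightarrow> cmod (\<sigma> t)"
      using tendsto_uniform_limitI[OF lim] by (intro tendsto_norm) auto
    show "\<exists>N. \<forall>m\<ge>N. cmod (\<Sum>n\<in>{- int m..int m}. fourier_coeff \<sigma> n * cis (of_int n * t)) \<le> M"
    proof (intro exI allI impI)
      fix m :: nat
      have "cmod (\<Sum>n\<in>{- int m..int m}. fourier_coeff \<sigma> n * cis (of_int n * t))
         \<le> (\<Sum>n\<in>{- int m..int m}. cmod (fourier_coeff \<sigma> n))"
        by (rule order_trans[OF norm_sum]) (simp add: norm_mult)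
      with part[of m] show "cmod (\<Sum>n\<in>{- int m..int m}. fourier_coeff \<sigma> n * cis (of_int n * t)) \<le> M"
        by linarith
    qed
  qed
qed

lemma gimt_fun_regular:
  assumes "gimt M \<alpha> \<sigma> \<phi>" "1 \<le> M"
  shows "continuous_on UNIV (gimt_fun N \<alpha> \<sigma> \<phi>)" and "cmod (gimt_fun N \<alpha> \<sigma> \<phi> t) \<le> M\<^sup>2"
proof -
  have sm: "smooth \<alpha>" "smooth \<phi>" "\<sigma> \<in> shape_functions M" and bd: "1 / M \<le> \<alpha> t" "\<alpha> t \<le> M"
    using assms by (auto simp: gimt_def)
  have pos: "0 \<le> 1 / M" using assms by simp
  show "continuous_on UNIV (gimt_fun N \<alpha> \<sigma> \<phi>)"
    unfolding gimt_fun_def[abs_def]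
    by (intro continuous_intros smooth_real_derivatives(3) sm
        continuous_on_compose2[OF shape_function_series(1)[OF sm(3)]]) auto
  have "\<bar>\<alpha> t\<bar> \<le> M" using bd pos by linarith
  then have "\<bar>\<alpha> t\<bar> * cmod (\<sigma> (2 * pi * N * \<phi> t)) \<le> M * M"
    using assms shape_function_series(5)[OF sm(3)] by (intro mult_mono) auto
  then show "cmod (gimt_fun N \<alpha> \<sigma> \<phi> t) \<le> M\<^sup>2"
    by (simp add: gimt_fun_def norm_mult power2_eq_square)
qed

text \<open>The pairing is continuous in the supremum norm, so uniform convergence of the Fourier series
  reduces the bound to its partial sums, for which the coefficients are summable with total at most \<open>M\<close>.\<close>
lemma pairing_gimt_fun_bound:
  assumes iw: "integrable lborel w" and g: "gimt M \<alpha> \<sigma> \<phi>" and M: "1 \<le> M" and "0 \<le> \<eta>"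
    and mode: "\<And>n. fourier_coeff \<sigma> n \<noteq> 0 \<Longrightarrow>
      cmod (packet_pairing w h a b (\<lambda>t. of_real (\<alpha> t) * cis (2 * pi * (of_int n * N) * \<phi> t))) \<le> \<eta>"
  shows "cmod (packet_pairing w h a b (gimt_fun N \<alpha> \<sigma> \<phi>)) \<le> M * \<eta>"
proof -
  have sm: "smooth \<alpha>" "smooth \<phi>" "\<sigma> \<in> shape_functions M" and bd: "1 / M \<le> \<alpha> t" "\<alpha> t \<le> M" for t
    using g by (auto simp: gimt_def)
  have \<alpha>: "\<bar>\<alpha> t\<bar> \<le> M" for t
  proof -
    have "0 \<le> 1 / M" using M by simp
    then show ?thesis using bd[of t] by linarith
  qed
  let ?I = "LINT u|lborel. cmod (w u)"
  have I0: "0 \<le> ?I" by (simp add: integral_nonneg_AE)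
  define e where "e n t = of_real (\<alpha> t) * cis (2 * pi * (of_int n * N) * \<phi> t)" for n :: int and t
  have ce: "continuous_on UNIV (e n)" for n unfolding e_def[abs_def]
    by (intro continuous_intros smooth_real_derivatives(3) sm)
  have be: "cmod (e n t) \<le> M" for n t using \<alpha> by (simp add: e_def norm_mult)
  define S where "S m t = (\<Sum>n\<in>{- int m..int m}. fourier_coeff \<sigma> n * e n t)" for m :: nat and t
  have S_eq: "S m t = of_real (\<alpha> t) *
    (\<Sum>n\<in>{- int m..int m}. fourier_coeff \<sigma> n * cis (of_int n * (2 * pi * N * \<phi> t)))" for m t
    unfolding S_def e_def sum_distrib_left by (intro sum.cong refl) (simp add: mult_ac)
  have cS: "continuous_on UNIV (S m)" for m unfolding S_def[abs_def]
    by (intro continuous_intros ce)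
  have pS: "cmod (packet_pairing w h a b (S m)) \<le> M * \<eta>" for m
  proof -
    have "packet_pairing w h a b (S m) =
      (LINT u|lborel. (\<Sum>n\<in>{- int m..int m}. fourier_coeff \<sigma> n *
         (cnj (w u) * cis (- (2 * pi * h * u * a)) * e n (b + h * u))))"
      unfolding packet_pairing_def S_def sum_distrib_left
      by (simp only: mult_ac)
    also have "\<dots> = (\<Sum>n\<in>{- int m..int m}. fourier_coeff \<sigma> n * packet_pairing w h a b (e n))"
      unfolding packet_pairing_def
      by (subst Bochner_Integration.integral_sum)
        (auto intro!: integrable_mult_right pairing_integrable[OF iw ce be])
    also have "cmod \<dots> \<le> (\<Sum>n\<in>{- int m..int m}. cmod (fourier_coeff \<sigma> n) * \<eta>)"
    proof (rule sum_norm_le)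
      fix n
      show "cmod (fourier_coeff \<sigma> n * packet_pairing w h a b (e n)) \<le> cmod (fourier_coeff \<sigma> n) * \<eta>"
        using mode[of n]
        by (cases "fourier_coeff \<sigma> n = 0") (auto simp: norm_mult e_def[abs_def] intro!: mult_left_mono)
    qed
    also have "\<dots> \<le> M * \<eta>"
      unfolding sum_distrib_right[symmetric]
      by (intro mult_right_mono shape_function_series(3)[OF sm(3)] \<open>0 \<le> \<eta>\<close>)
    finally show ?thesis .
  qed
  let ?f = "gimt_fun N \<alpha> \<sigma> \<phi>"
  show ?thesis
  proof (rule field_le_epsilon)
    fix \<delta> :: real assume "0 < \<delta>"
    \<comment> \<open>The added 1 keeps the denominator positive when \<open>w\<close> vanishes almost everywhere.\<close>
    define \<kappa> where "\<kappa> = \<delta> / (M * (?I + 1))"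
    have \<kappa>: "0 < \<kappa>" unfolding \<kappa>_def
    using \<open>0 < \<delta>\<close> M I0 by (intro divide_pos_pos mult_pos_pos add_nonneg_pos) linarith+
    obtain m :: nat where m: "\<And>t. cmod ((\<Sum>n\<in>{- int m..int m}. fourier_coeff \<sigma> n * cis (of_int n * t)) - \<sigma> t) < \<kappa>"
      using uniform_limitD[OF shape_function_series(4)[OF sm(3)] \<kappa>]
      by (auto simp: dist_norm eventually_sequentially)
    define r where "r t = ?f t - S m t" for t
    have br: "cmod (r t) \<le> M * \<kappa>" for t
    proof -
      let ?x = "2 * pi * N * \<phi> t"
      have "r t = of_real (\<alpha> t) * - ((\<Sum>n\<in>{- int m..int m}. fourier_coeff \<sigma> n * cis (of_int n * ?x)) - \<sigma> ?x)"
        unfolding r_def S_eq gimt_fun_def by (simp add: algebra_simps)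
      then have "cmod (r t) = \<bar>\<alpha> t\<bar> * cmod ((\<Sum>n\<in>{- int m..int m}. fourier_coeff \<sigma> n * cis (of_int n * ?x)) - \<sigma> ?x)"
        by (simp only: norm_mult norm_minus_cancel norm_of_real)
      also have "\<dots> \<le> M * \<kappa>" using \<alpha> m[of ?x] M by (intro mult_mono) auto
      finally show ?thesis .
    qed
    have cr: "continuous_on UNIV r" unfolding r_def[abs_def]
      by (intro continuous_intros gimt_fun_regular(1)[OF g M] cS)
    have bS: "cmod (S m t) \<le> M * \<kappa> + M\<^sup>2" for t
      using br[of t] gimt_fun_regular(2)[OF g M, of N t] norm_triangle_ineq4[of "?f t" "r t"]
      by (simp add: r_def)
    define p where "p u = cnj (w u) * cis (- (2 * pi * h * u * a)) * r (b + h * u)" for u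
    define q where "q u = cnj (w u) * cis (- (2 * pi * h * u * a)) * S m (b + h * u)" for u
    have int: "integrable lborel p" "integrable lborel q"
      unfolding p_def q_def
      by (rule pairing_integrable[OF iw cr br], rule pairing_integrable[OF iw cS bS])
    have "packet_pairing w h a b ?f = (LINT u|lborel. p u + q u)"
      unfolding packet_pairing_def p_def q_def distrib_left[symmetric] r_def by simp
    also have "\<dots> = packet_pairing w h a b r + packet_pairing w h a b (S m)"
      unfolding Bochner_Integration.integral_add[OF int]
      by (simp only: packet_pairing_def p_def[abs_def] q_def[abs_def])
    also have "cmod \<dots> \<le> M * \<kappa> * ?I + M * \<eta>"
      by (rule order_trans[OF norm_triangle_ineq add_mono[OF pairing_norm_le[OF iw cr br] pS]])
    also have "M * \<kappa> * ?I \<le> \<delta>"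
    proof -
      have "M * \<kappa> * ?I \<le> M * \<kappa> * (?I + 1)" using M \<kappa> by (intro mult_left_mono) auto
      also have "\<dots> = \<delta>"
      proof -
        have "?I + 1 \<noteq> 0" using I0 by linarith
        then show ?thesis using M by (simp add: \<kappa>_def)
      qed
      finally show ?thesis .
    qed
    finally show "cmod (packet_pairing w h a b ?f) \<le> M * \<eta> + \<delta>" by simp
  qed
qed

text \<open>The bound \<open>1 \<le> M\<close> follows from \<open>1 / M \<le> \<alpha> \<le> M\<close>, hence only if there is a component at all.\<close>
lemma superposition_regular:
  assumes "\<And>k. k \<in> {1..K} \<Longrightarrow> gimt M (\<alpha> k) (sh k) (\<phi> k)" "K \<noteq> 0 \<Longrightarrow> 1 \<le> M"
  shows "continuous_on UNIV (superposition K Ns \<alpha> sh \<phi>)"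
    and "cmod (superposition K Ns \<alpha> sh \<phi> t) \<le> of_nat K * M\<^sup>2"
proof -
  have M: "1 \<le> M" if "k \<in> {1..K}" for k using assms(2) that by fastforce
  show "continuous_on UNIV (superposition K Ns \<alpha> sh \<phi>)"
    unfolding superposition_def[abs_def]
    by (intro continuous_intros gimt_fun_regular(1)[OF assms(1) M])
  have "cmod (superposition K Ns \<alpha> sh \<phi> t) \<le> (\<Sum>k=1..K. M\<^sup>2)"
    unfolding superposition_def
    by (rule sum_norm_le) (rule gimt_fun_regular(2)[OF assms(1) M])
  then show "cmod (superposition K Ns \<alpha> sh \<phi> t) \<le> of_nat K * M\<^sup>2" by simp
qed

lemma pairing_superposition_bound:
  assumes iw: "integrable lborel w"
    and g: "\<And>k. k \<in> {1..K} \<Longrightarrow> gimt M (\<alpha> k) (sh k) (\<phi> k)" and M: "K \<noteq> 0 \<Longrightarrow> 1 \<le> M" and "0 \<le> \<eta>"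
    and mode: "\<And>n k. (n, k) \<in> active K sh \<Longrightarrow> cmod (packet_pairing w h a b
        (\<lambda>t. of_real (\<alpha> k t) * cis (2 * pi * (of_int n * Ns k) * \<phi> k t))) \<le> \<eta>"
  shows "cmod (packet_pairing w h a b (superposition K Ns \<alpha> sh \<phi>)) \<le> of_nat K * (M * \<eta>)"
proof -
  have M': "1 \<le> M" if "k \<in> {1..K}" for k using M that by fastforce
  let ?f = "\<lambda>k. gimt_fun (Ns k) (\<alpha> k) (sh k) (\<phi> k)"
  have "packet_pairing w h a b (superposition K Ns \<alpha> sh \<phi>) =
     (LINT u|lborel. (\<Sum>k=1..K. cnj (w u) * cis (- (2 * pi * h * u * a)) * ?f k (b + h * u)))"
    unfolding packet_pairing_def superposition_def sum_distrib_left ..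
  also have "\<dots> = (\<Sum>k=1..K. packet_pairing w h a b (?f k))"
    unfolding packet_pairing_def
    by (rule Bochner_Integration.integral_sum)
      (rule pairing_integrable[OF iw gimt_fun_regular[OF g M']])
  also have "cmod \<dots> \<le> (\<Sum>k=1..K. M * \<eta>)"
  proof (rule sum_norm_le)
    fix k assume k: "k \<in> {1..K}"
    show "cmod (packet_pairing w h a b (?f k)) \<le> M * \<eta>"
      using mode k by (intro pairing_gimt_fun_bound[OF iw g[OF k] M'[OF k] \<open>0 \<le> \<eta>\<close>])
        (auto simp: active_def)
  qed
  finally show ?thesis by simp
qed

section \<open>The derivative of the transform\<close>

lemma quadratic_decay_increment:
  fixes q q' :: "real \<Rightarrow> complex"
  assumes q: "\<And>x. (q has_vector_derivative q' x) (at x)" "\<And>x. cmod (q' x) \<le> D / (1 + x\<^sup>2)"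
    and near: "\<bar>y' - y\<bar> \<le> 1"
  shows "cmod (q y' - q y) \<le> \<bar>y' - y\<bar> * (3 * D / (1 + y\<^sup>2))"
proof -
  have D0: "0 \<le> D" using order_trans[OF norm_ge_zero q(2)[of 0]] by simp
  have pos: "0 < 1 + z\<^sup>2" for z :: real by (simp add: add_pos_nonneg)
  have "norm (q y' - q y) \<le> norm (y' - y) * (3 * D / (1 + y\<^sup>2))"
  proof (subst mult.commute, rule differentiable_bound[where S = "closed_segment y y'" and f' = "\<lambda>z h. h *\<^sub>R q' z"])
    show "(q has_derivative (\<lambda>h. h *\<^sub>R q' z)) (at z within closed_segment y y')" for z
      using has_vector_derivative_at_within[OF q(1)] by (simp add: has_vector_derivative_def)
    show "onorm (\<lambda>h. h *\<^sub>R q' z) \<le> 3 * D / (1 + y\<^sup>2)" if "z \<in> closed_segment y y'" for z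
    proof (rule onorm_le)
      have "\<bar>y - z\<bar> \<le> 1"
        using that near by (auto simp: closed_segment_eq_real_ivl split: if_splits)
      then have "(y - z)\<^sup>2 \<le> 1" by (simp add: abs_square_le_1)
      \<comment> \<open>Moving by at most 1 changes the majorant by a factor of at most 3.\<close>
      then have "0 \<le> (y - 2 * z)\<^sup>2 + z\<^sup>2 + 2 * (1 - (y - z)\<^sup>2)" by simp
      also have "\<dots> = 3 * (1 + z\<^sup>2) - (1 + y\<^sup>2)"
        by (simp add: power2_eq_square algebra_simps)
      finally have "1 + y\<^sup>2 \<le> 3 * (1 + z\<^sup>2)" by linarith
      then have "D * (1 + y\<^sup>2) \<le> D * (3 * (1 + z\<^sup>2))" using D0 by (rule mult_left_mono)
      then have "D / (1 + z\<^sup>2) \<le> 3 * D / (1 + y\<^sup>2)" using pos[of y] pos[of z] by (simp add: field_simps)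
      then have "cmod (q' z) \<le> 3 * D / (1 + y\<^sup>2)" using q(2)[of z] by linarith
      then show "norm (h *\<^sub>R q' z) \<le> 3 * D / (1 + y\<^sup>2) * norm h" for h
        by (metis norm_scaleR mult.commute mult_right_mono norm_ge_zero real_norm_def)
    qed
  qed auto
  then show ?thesis by simp
qed

text \<open>Differentiation under the integral by dominated convergence. The derivative is put on \<open>q\<close>, since
  \<open>f\<close> is only continuous; the difference quotients of \<open>q\<close> inherit its quadratic decay uniformly.\<close>
lemma convolution_has_vector_derivative:
  fixes q q' f :: "real \<Rightarrow> complex"
  assumes q: "\<And>x. (q has_vector_derivative q' x) (at x)" and cq': "continuous_on UNIV q'"
    and dec: "\<And>x. cmod (q x) \<le> D / (1 + x\<^sup>2)" "\<And>x. cmod (q' x) \<le> D / (1 + x\<^sup>2)"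
    and f: "continuous_on UNIV f" "\<And>t. cmod (f t) \<le> B"
  shows "((\<lambda>b. LINT t|lborel. q (t - b) * f t) has_vector_derivative
           - (LINT t|lborel. q' (t - b) * f t)) (at b)"
proof -
  have B0: "0 \<le> B" using order_trans[OF norm_ge_zero f(2)[of 0]] .
  have D0: "0 \<le> D" using order_trans[OF norm_ge_zero dec(1)[of 0]] by simp
  have cq: "continuous_on UNIV q"
    using q by (meson continuous_at_imp_continuous_on has_vector_derivative_continuous)
  have shift: "integrable lborel (\<lambda>t. p (t - x) * f t)"
    if "continuous_on UNIV p" "\<And>x. cmod (p x) \<le> D / (1 + x\<^sup>2)" for p x
  proof -
    have "integrable lborel (\<lambda>t. p (- x + 1 * t))"
      by (rule lborel_integrable_real_affine[OF integrable_of_quadratic_decay[OF that]]) simp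
    then have "integrable lborel (\<lambda>t. p (t - x))" by (simp add: add.commute)
    from integrable_mult_bounded_continuous[OF this f] show ?thesis .
  qed
  note int = shift[OF cq dec(1)] shift[OF cq' dec(2)]
  \<comment> \<open>The remainder quotient whose vanishing at \<open>b\<close> is the differentiability of the integrand.\<close>
  define r where "r x t = (q (t - x) * f t - q (t - b) * f t - (x - b) *\<^sub>R - (q' (t - b) * f t)) /\<^sub>R norm (x - b)" for x t
  have int_r: "integrable lborel (r x)" for x
    unfolding r_def[abs_def] using int by simp
  have meas: "r x \<in> borel_measurable lborel" for x using int_r by (rule borel_measurable_integrable)
  have pointwise: "((\<lambda>x. r x t) \<longlongrightarrow> 0) (at b)" for t
  proof -
    have "((\<lambda>x. q (t - x)) has_vector_derivative (- 1) *\<^sub>R q' (t - b)) (at b)"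
    proof -
      have "((\<lambda>x. t - x) has_vector_derivative - 1) (at b)"
        by (auto intro!: derivative_eq_intros)
      from vector_diff_chain_at[OF this q[of "t - b"]] show ?thesis by (simp add: comp_def)
    qed
    then have "((\<lambda>x. q (t - x) * f t) has_vector_derivative - (q' (t - b) * f t)) (at b)"
      using has_vector_derivative_mult_left[of "\<lambda>x. q (t - x)" _ "at b" "f t"] by fastforce
    then show ?thesis
      by (simp add: has_vector_derivative_def has_derivative_at_within r_def)
  qed
  have bound: "cmod (r x t) \<le> 4 * D * B * inverse (1 + (t - b)\<^sup>2)" if "x \<noteq> b" "\<bar>x - b\<bar> \<le> 1" for x t
  proof -
    let ?y = "t - b" and ?y' = "t - x"
    have "r x t = ((q ?y' - q ?y) + (x - b) *\<^sub>R q' ?y) * f t /\<^sub>R \<bar>x - b\<bar>"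
      by (simp add: r_def algebra_simps)
    then have "cmod (r x t) = cmod ((q ?y' - q ?y) + (x - b) *\<^sub>R q' ?y) * cmod (f t) / \<bar>x - b\<bar>"
      by (simp add: norm_mult divide_inverse)
    also have "\<dots> \<le> (\<bar>x - b\<bar> * (3 * D / (1 + ?y\<^sup>2)) + \<bar>x - b\<bar> * (D / (1 + ?y\<^sup>2))) * B / \<bar>x - b\<bar>"
    proof (intro divide_right_mono mult_mono f order_trans[OF norm_triangle_ineq] add_mono)
      show "cmod (q ?y' - q ?y) \<le> \<bar>x - b\<bar> * (3 * D / (1 + ?y\<^sup>2))"
        using quadratic_decay_increment[OF q dec(2), of ?y' ?y] that by (simp add: abs_minus_commute)
      show "cmod ((x - b) *\<^sub>R q' ?y) \<le> \<bar>x - b\<bar> * (D / (1 + ?y\<^sup>2))"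
        using mult_left_mono[OF dec(2)[of ?y], of "\<bar>x - b\<bar>"] by simp
    qed (use D0 B0 in auto)
    also have "\<dots> = 4 * D * B * inverse (1 + ?y\<^sup>2)"
      using that(1) by (simp add: divide_inverse algebra_simps)
    finally show ?thesis .
  qed
  have majorant: "integrable lborel (\<lambda>t. 4 * D * B * inverse (1 + (t - b)\<^sup>2))"
  proof -
    have "integrable lborel (\<lambda>t. inverse (1 + (- b + 1 * t)\<^sup>2))"
      by (rule lborel_integrable_real_affine[OF integrable_inverse_quadratic]) simp
    then show ?thesis by (intro integrable_mult_right) (simp add: add.commute)
  qed
  have "((\<lambda>x. LINT t|lborel. r x t) \<longlongrightarrow> 0) (at b)"
    unfolding tendsto_at_iff_sequentially comp_def
  proof (intro allI impI)
    fix S assume S: "\<forall>i. S i \<in> UNIV - {b}" "S \<longlonglongrightarrow> b"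
    obtain m where m: "\<And>i. m \<le> i \<Longrightarrow> \<bar>S i - b\<bar> < 1"
      using LIMSEQ_D[OF S(2), of 1] by auto
    have "(\<lambda>i. LINT t|lborel. r (S (i + m)) t) \<longlonglongrightarrow> (LINT t|(lborel :: real measure). 0)"
    proof (rule integral_dominated_convergence[where s = "\<lambda>i. r (S (i + m))"
          and w = "\<lambda>t. 4 * D * B * inverse (1 + (t - b)\<^sup>2)"])
      show "AE t in lborel. (\<lambda>i. r (S (i + m)) t) \<longlonglongrightarrow> 0"
      proof (intro AE_I2)
        fix t
        have "(\<lambda>i. r (S i) t) \<longlonglongrightarrow> 0"
          using pointwise[of t] S unfolding tendsto_at_iff_sequentially comp_def by blast
        then show "(\<lambda>i. r (S (i + m)) t) \<longlonglongrightarrow> 0" by (rule LIMSEQ_ignore_initial_segment)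
      qed
      show "AE t in lborel. norm (r (S (i + m)) t) \<le> 4 * D * B * inverse (1 + (t - b)\<^sup>2)" for i
        using S(1) m[of "i + m"] by (intro AE_I2 bound) auto
    qed (use meas majorant in auto)
    then show "(\<lambda>i. LINT t|lborel. r (S i) t) \<longlonglongrightarrow> 0"
      by (simp add: LIMSEQ_offset[where k = m])
  qed
  moreover have "(LINT t|lborel. r x t) =
     ((LINT t|lborel. q (t - x) * f t) - (LINT t|lborel. q (t - b) * f t)
        - (x - b) *\<^sub>R - (LINT t|lborel. q' (t - b) * f t)) /\<^sub>R norm (x - b)" for x
    unfolding r_def using int by simp
  ultimately show ?thesis
    by (auto simp: has_vector_derivative_def has_derivative_at_within
        intro!: bounded_linear_minus bounded_linear_scaleR_left)
qed

text \<open>The derivative in \<open>b\<close> falls on the packet: on its oscillating factor, where it gives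
  \<open>2 \<pi> \<i> a\<close>, and on its envelope, where it gives the packet of \<open>w'\<close>.\<close>
lemma wp_transform_has_vector_derivative:
  assumes w: "schwartz w" and f: "continuous_on UNIV f" "\<And>t. cmod (f t) \<le> B" and a: "1 \<le> \<bar>a\<bar>" and s: "0 \<le> s"
  shows "((\<lambda>b. wp_transform w s f a b) has_vector_derivative
     2 * of_real pi * \<i> * of_real a * wp_transform w s f a b
       - of_real (\<bar>a\<bar> powr s) * wp_transform (nth_vderiv 1 w) s f a b) (at b)"
proof -
  let ?w' = "nth_vderiv 1 w"
  have ws: "smooth w" using w by (simp add: schwartz_def)
  obtain D0 where D0: "\<And>x. cmod (w x) \<le> D0 / (1 + x\<^sup>2)"
    using schwartz_decay[OF w, of 0] unfolding nth_vderiv_0 by metis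
  obtain D1 where D1: "\<And>x. cmod (?w' x) \<le> D1 / (1 + x\<^sup>2)"
    using schwartz_decay[OF w, of 1] by metis
  have D_pos: "0 \<le> D0" "0 \<le> D1"
    using order_trans[OF norm_ge_zero D0[of 0]] order_trans[OF norm_ge_zero D1[of 0]] by auto
  define A where "A = \<bar>a\<bar> powr s"
  define c where "c = \<bar>a\<bar> powr (s / 2)"
  have A: "1 \<le> A" using a s by (simp add: A_def ge_one_powr_ge_zero)
  have c: "0 \<le> c" by (simp add: c_def)
  have shrink: "E / (1 + (A * y)\<^sup>2) \<le> E / (1 + y\<^sup>2)" if "0 \<le> E" for E y
  proof (rule divide_left_mono[OF _ that])
    have "1 * y\<^sup>2 \<le> A\<^sup>2 * y\<^sup>2" using A by (intro mult_right_mono) auto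
    then show "1 + y\<^sup>2 \<le> 1 + (A * y)\<^sup>2" by (simp add: power_mult_distrib)
    show "0 < (1 + (A * y)\<^sup>2) * (1 + y\<^sup>2)" by (simp add: add_pos_nonneg)
  qed
  define p where "p y = w (A * y) * cis (2 * pi * y * a)" for y
  define p1 where "p1 y = ?w' (A * y) * cis (2 * pi * y * a)" for y
  define q where "q y = of_real c * cnj (p y)" for y
  define q' where "q' y = of_real c * cnj (of_real A * p1 y + 2 * of_real pi * \<i> * of_real a * p y)" for y
  have cw: "continuous_on UNIV w" "continuous_on UNIV ?w'"
    using smooth_continuous[OF ws, of 0] smooth_continuous[OF ws, of 1] by auto
  have bp: "cmod (p y) \<le> D0 / (1 + y\<^sup>2)" "cmod (p1 y) \<le> D1 / (1 + y\<^sup>2)" for y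
    using order_trans[OF D0 shrink[OF D_pos(1)]] order_trans[OF D1 shrink[OF D_pos(2)]]
    by (simp_all add: p_def p1_def norm_mult)
  define D where "D = c * D0 + c * (A * D1 + 2 * pi * \<bar>a\<bar> * D0)"
  have bq: "cmod (q y) \<le> D / (1 + y\<^sup>2)" for y
  proof -
    have "cmod (q y) \<le> c * (D0 / (1 + y\<^sup>2))"
      using mult_left_mono[OF bp(1)[of y] c] c by (simp add: q_def norm_mult)
    also have "\<dots> = (c * D0) / (1 + y\<^sup>2)" by simp
    also have "\<dots> \<le> D / (1 + y\<^sup>2)" unfolding D_def using A D_pos c
      by (intro divide_right_mono) (auto intro!: mult_nonneg_nonneg add_nonneg_nonneg)
    finally show ?thesis .
  qed
  have bq': "cmod (q' y) \<le> D / (1 + y\<^sup>2)" for y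
  proof -
    have "cmod (q' y) = c * cmod (of_real A * p1 y + 2 * of_real pi * \<i> * of_real a * p y)"
      using c by (simp only: q'_def norm_mult complex_mod_cnj) simp
    also have "\<dots> \<le> c * (A * (D1 / (1 + y\<^sup>2)) + 2 * pi * \<bar>a\<bar> * (D0 / (1 + y\<^sup>2)))"
    proof (intro mult_left_mono[OF _ c] order_trans[OF norm_triangle_ineq] add_mono)
      show "cmod (of_real A * p1 y) \<le> A * (D1 / (1 + y\<^sup>2))"
        using mult_left_mono[OF bp(2)[of y], of A] A by (simp add: norm_mult)
      show "cmod (2 * of_real pi * \<i> * of_real a * p y) \<le> 2 * pi * \<bar>a\<bar> * (D0 / (1 + y\<^sup>2))"
        using mult_left_mono[OF bp(1)[of y], of "2 * pi * \<bar>a\<bar>"] by (simp add: norm_mult)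
    qed
    also have "\<dots> = (c * (A * D1 + 2 * pi * \<bar>a\<bar> * D0)) / (1 + y\<^sup>2)"
      by (simp add: add_divide_distrib distrib_left)
    also have "\<dots> \<le> D / (1 + y\<^sup>2)" unfolding D_def using D_pos c
      by (intro divide_right_mono) auto
    finally show ?thesis .
  qed
  have dp: "(p has_vector_derivative of_real A * p1 y + 2 * of_real pi * \<i> * of_real a * p y) (at y)" for y
  proof -
    have "((\<lambda>y. A * y) has_vector_derivative A) (at y)"
      by (auto intro!: derivative_eq_intros simp flip: has_real_derivative_iff_has_vector_derivative)
    from vector_diff_chain_at[OF this smooth_has_vector_derivative[OF ws, of 0, simplified]]
    have 1: "((\<lambda>y. w (A * y)) has_vector_derivative A *\<^sub>R ?w' (A * y)) (at y)"
      by (simp add: comp_def)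
    have 2: "((\<lambda>y. cis (2 * pi * y * a)) has_vector_derivative
        of_real (2 * pi * a) * (\<i> * cis (2 * pi * y * a))) (at y)"
      by (rule has_vector_derivative_cis) (auto intro!: derivative_eq_intros)
    show ?thesis
      using has_vector_derivative_mult[OF 1 2]
      by (simp add: p_def[abs_def] p1_def scaleR_conv_of_real algebra_simps)
  qed
  have dq: "(q has_vector_derivative q' y) (at y)" for y
    unfolding q_def[abs_def] q'_def
    by (intro has_vector_derivative_mult_right has_vector_derivative_cnj dp)
  have cq': "continuous_on UNIV q'" unfolding q'_def[abs_def] p_def p1_def
    by (intro continuous_intros continuous_on_compose2[OF cw(1)] continuous_on_compose2[OF cw(2)]) auto
  have packet: "wp_transform u s f a b' = (LINT t|lborel.
      of_real c * cnj (u (A * (t - b')) * cis (2 * pi * (t - b') * a)) * f t)" for u b'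
    unfolding wp_transform_def wave_packet_def A_def c_def by (simp add: mult_ac)
  have W: "wp_transform w s f a b' = (LINT t|lborel. q (t - b') * f t)" for b'
    unfolding packet q_def p_def ..
  have W1: "wp_transform ?w' s f a b = (LINT t|lborel. of_real c * cnj (p1 (t - b)) * f t)"
    unfolding packet p1_def ..
  have int: "integrable lborel (\<lambda>t. of_real c * cnj (g (A * (t - b)) * cis (2 * pi * (t - b) * a)) * f t)"
    if "continuous_on UNIV g" "\<And>y. cmod (g y) \<le> E / (1 + y\<^sup>2)" for g E
  proof -
    have E: "0 \<le> E" using order_trans[OF norm_ge_zero that(2)[of 0]] by simp
    let ?k = "\<lambda>y. of_real c * cnj (g (A * y) * cis (2 * pi * y * a))"
    have "cmod (?k y) \<le> (c * E) / (1 + y\<^sup>2)" for y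
      using mult_left_mono[OF order_trans[OF that(2) shrink[OF E]] c, of y] c
      by (simp add: norm_mult)
    moreover have "continuous_on UNIV ?k"
      by (intro continuous_intros continuous_on_compose2[OF that(1)]) auto
    ultimately have "integrable lborel ?k" by (intro integrable_of_quadratic_decay)
    from lborel_integrable_real_affine[OF this, of 1 "- b"]
    have "integrable lborel (\<lambda>t. ?k (t - b))" by (simp add: add.commute)
    from integrable_mult_bounded_continuous[OF this f] show ?thesis .
  qed
  have i1: "integrable lborel (\<lambda>t. of_real c * cnj (p1 (t - b)) * f t)"
    unfolding p1_def by (rule int[OF cw(2) D1])
  have i0: "integrable lborel (\<lambda>t. q (t - b) * f t)"
    unfolding q_def p_def by (rule int[OF cw(1) D0])
  have "- (LINT t|lborel. q' (t - b) * f t) =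
    - (LINT t|lborel. of_real A * (of_real c * cnj (p1 (t - b)) * f t)
        - 2 * of_real pi * \<i> * of_real a * (q (t - b) * f t))"
    by (simp add: q'_def q_def algebra_simps)
  also have "\<dots> = 2 * of_real pi * \<i> * of_real a * wp_transform w s f a b
       - of_real A * wp_transform ?w' s f a b"
    unfolding W W1 using i0 i1
    by (subst Bochner_Integration.integral_diff) auto
  finally have eq: "- (LINT t|lborel. q' (t - b) * f t) =
    2 * of_real pi * \<i> * of_real a * wp_transform w s f a b - of_real A * wp_transform ?w' s f a b" .
  have "((\<lambda>b. LINT t|lborel. q (t - b) * f t) has_vector_derivative
     - (LINT t|lborel. q' (t - b) * f t)) (at b)"
    by (rule convolution_has_vector_derivative[OF dq cq' bq bq' f])
  then show ?thesis unfolding eq A_def[symmetric] W[symmetric] .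
qed

text \<open>Where the transform is not small, the instantaneous frequency is within \<open>O(\<bar>a\<bar>\<^sup>s)\<close> of the
  packet frequency \<open>a\<close>, because the other part of the \<open>b\<close>-derivative is \<open>\<bar>a\<bar>\<^sup>s\<close> times a transform that is
  \<open>O(\<bar>a\<bar>\<^bsup>-s/2\<^esup>)\<close>, the order of the assumed lower bound.\<close>
lemma inst_freq_near_packet_frequency:
  assumes w: "schwartz w" and f: "continuous_on UNIV f" "\<And>t. cmod (f t) \<le> B" and a: "1 \<le> \<bar>a\<bar>" and s: "0 \<le> s"
    and \<epsilon>: "0 < \<epsilon>" and big: "\<bar>a\<bar> powr (- s / 2) * sqrt \<epsilon> \<le> cmod (wp_transform w s f a b)"
  obtains v where "inst_freq w s f a b = Some v"
    and "cmod (v - of_real a) \<le> \<bar>a\<bar> powr s * (B * (LINT u|lborel. cmod (nth_vderiv 1 w u)) / sqrt \<epsilon>)"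
proof -
  let ?W = "wp_transform w s f a b" and ?W1 = "wp_transform (nth_vderiv 1 w) s f a b"
  let ?c = "\<bar>a\<bar> powr (- s / 2)" and ?I = "LINT u|lborel. cmod (nth_vderiv 1 w u)"
  have c: "0 < ?c" using a by simp
  have lower: "0 < ?c * sqrt \<epsilon>" using c \<epsilon> by simp
  then have W: "0 < cmod ?W" using big by linarith
  then have W0: "?W \<noteq> 0" by auto
  have B0: "0 \<le> B" using order_trans[OF norm_ge_zero f(2)[of 0]] .
  have I0: "0 \<le> B * ?I" using B0 by (simp add: integral_nonneg_AE)
  define v where "v = vector_derivative (\<lambda>b'. wp_transform w s f a b') (at b) / (2 * of_real pi * \<i> * ?W)"
  have "v = of_real a - of_real (\<bar>a\<bar> powr s) * ?W1 / (2 * of_real pi * \<i> * ?W)"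
    unfolding v_def vector_derivative_at[OF wp_transform_has_vector_derivative[OF w f a s]]
    using W0 by (simp add: diff_divide_distrib)
  then have "cmod (v - of_real a) = \<bar>a\<bar> powr s * (cmod ?W1 / (2 * pi * cmod ?W))"
    by (simp add: norm_mult norm_divide)
  also have "\<dots> \<le> \<bar>a\<bar> powr s * (?c * (B * ?I) / (1 * (?c * sqrt \<epsilon>)))"
  proof (intro mult_left_mono frac_le mult_mono)
    have "cmod ?W1 = ?c * cmod (packet_pairing (nth_vderiv 1 w) (\<bar>a\<bar> powr (- s)) a b f)"
      by (simp add: wp_transform_eq_pairing[OF a] norm_mult del: One_nat_def)
    also have "\<dots> \<le> ?c * (B * ?I)"
      using c by (intro mult_left_mono pairing_norm_le[OF schwartz_integrable(1)[OF w] f]) auto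
    finally show "cmod ?W1 \<le> ?c * (B * ?I)" .
  qed (use pi_gt3 big lower I0 c in auto)
  also have "\<dots> = \<bar>a\<bar> powr s * (B * ?I / sqrt \<epsilon>)" using c by simp
  finally have "cmod (v - of_real a) \<le> \<bar>a\<bar> powr s * (B * ?I / sqrt \<epsilon>)" .
  moreover have "inst_freq w s f a b = Some v" using W by (simp add: inst_freq_def v_def)
  ultimately show thesis by (intro that)
qed

section \<open>Geometry of the frequency bands\<close>

text \<open>Above \<open>1\<close> the derivative \<open>s z\<^bsup>s-1\<^esup>\<close> is at most \<open>s\<close>, so for \<open>d \<le> 1\<close> the half-width \<open>d \<bar>a\<bar>\<^sup>s\<close> of a
  band is a strict contraction in \<open>a\<close>. This is what tells open and closed bands apart.\<close>
lemma powr_contraction: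
  fixes x y s :: real
  assumes s: "0 < s" "s \<le> 1" and "1 \<le> x" "1 \<le> y"
  shows "\<bar>x powr s - y powr s\<bar> \<le> s * \<bar>x - y\<bar>"
proof -
  have "norm (x powr s - y powr s) \<le> s * norm (x - y)"
  proof (rule field_differentiable_bound[where S = "{1..}" and f' = "\<lambda>z. s * z powr (s - 1)"])
    show "((\<lambda>z. z powr s) has_field_derivative s * z powr (s - 1)) (at z within {1..})"
      if "z \<in> {1..}" for z :: real
      using that by (auto intro!: derivative_eq_intros)
    show "norm (s * z powr (s - 1)) \<le> s" if "z \<in> {1..}" for z :: real
      using that s powr_mono[of "s - 1" 0 z] by (auto simp: abs_mult)
  qed (use assms in auto)
  then show ?thesis by simp
qed

lemma band_width_contraction:
  fixes a a' :: real
  assumes "0 < s" "s < 1" "0 < d" "d \<le> 1" "1 \<le> \<bar>a\<bar>" "1 \<le> \<bar>a'\<bar>" "a \<noteq> a'"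
  shows "\<bar>d * \<bar>a'\<bar> powr s - d * \<bar>a\<bar> powr s\<bar> < \<bar>a' - a\<bar>"
proof -
  have "\<bar>d * \<bar>a'\<bar> powr s - d * \<bar>a\<bar> powr s\<bar> = d * \<bar>\<bar>a'\<bar> powr s - \<bar>a\<bar> powr s\<bar>"
    using assms by (simp add: abs_mult flip: right_diff_distrib)
  also have "\<dots> \<le> 1 * (s * \<bar>\<bar>a'\<bar> - \<bar>a\<bar>\<bar>)"
    using assms by (intro mult_mono powr_contraction) auto
  also have "\<dots> \<le> s * \<bar>a' - a\<bar>" using assms by (auto intro!: mult_left_mono)
  also have "\<dots> < \<bar>a' - a\<bar>" using assms by (simp add: mult_less_cancel_right1)
  finally show ?thesis .
qed

text \<open>A small step of \<open>a\<close> towards the centre \<open>x\<close> enters the open band around \<open>x\<close>, since the band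
  width changes more slowly than the distance to the centre.\<close>
lemma closed_band_meets_open_band:
  fixes a x y :: real
  assumes s: "0 < s" "s < 1" and d: "0 < d" "d \<le> 1" and a: "1 < \<bar>a\<bar>"
    and x: "\<bar>a - x\<bar> \<le> d * \<bar>a\<bar> powr s" and y: "\<bar>a - y\<bar> < d * \<bar>a\<bar> powr s"
  shows "\<exists>a'. 1 \<le> \<bar>a'\<bar> \<and> \<bar>a' - x\<bar> < d * \<bar>a'\<bar> powr s \<and> \<bar>a' - y\<bar> < d * \<bar>a'\<bar> powr s"
proof (cases "\<bar>a - x\<bar> < d * \<bar>a\<bar> powr s")
  case True
  then show ?thesis using less_imp_le[OF a] y by blast
next
  case False
  have a0: "a \<noteq> 0" using a by auto
  have ax: "a \<noteq> x" using False d a0 by auto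
  define g where "g t = a - t * sgn (a - x)" for t
  have lim: "(g \<longlongrightarrow> a) (at_right 0)"
    unfolding g_def by (auto intro!: tendsto_eq_intros)
  have "((\<lambda>t. \<bar>g t\<bar>) \<longlongrightarrow> \<bar>a\<bar>) (at_right 0)" by (intro tendsto_intros lim)
  then have e1: "\<forall>\<^sub>F t in at_right 0. 1 < \<bar>g t\<bar>" using a by (rule order_tendstoD)
  have "((\<lambda>t. d * \<bar>g t\<bar> powr s - \<bar>g t - y\<bar>) \<longlongrightarrow> d * \<bar>a\<bar> powr s - \<bar>a - y\<bar>) (at_right 0)"
    using a0 by (intro tendsto_intros lim) auto
  then have e2: "\<forall>\<^sub>F t in at_right 0. 0 < d * \<bar>g t\<bar> powr s - \<bar>g t - y\<bar>"
    using y by (intro order_tendstoD) auto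
  have e3: "\<forall>\<^sub>F t in at_right 0. 0 < t \<and> t < \<bar>a - x\<bar>"
    using eventually_at_right_real[of 0 "\<bar>a - x\<bar>"] ax by simp
  obtain t where t: "1 < \<bar>g t\<bar>" "0 < d * \<bar>g t\<bar> powr s - \<bar>g t - y\<bar>" "0 < t" "t < \<bar>a - x\<bar>"
    using eventually_happens[OF eventually_conj[OF e1 eventually_conj[OF e2 e3]]] by auto
  have dist: "\<bar>g t - x\<bar> = \<bar>a - x\<bar> - t" "\<bar>g t - a\<bar> = t"
    using t by (auto simp: g_def sgn_if abs_if split: if_splits)
  have "\<bar>d * \<bar>g t\<bar> powr s - d * \<bar>a\<bar> powr s\<bar> < \<bar>g t - a\<bar>"
    using t dist a by (intro band_width_contraction s d) auto
  then have "\<bar>g t - x\<bar> < d * \<bar>g t\<bar> powr s" using dist x by linarith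
  then show ?thesis using t by (intro exI[of _ "g t"]) auto
qed

text \<open>From a boundary point every step away from the centre leaves the closed band, so such a point is
  not interior.\<close>
lemma interior_Z_set:
  assumes s: "0 < s" "s < 1" and d: "0 < d" "d \<le> 1" and a: "1 < \<bar>a\<bar>"
    and int: "(a, b) \<in> interior (Z_set d s Ns \<phi> n k)"
  shows "\<bar>a - of_int n * Ns k * deriv (\<phi> k) b\<bar> < d * \<bar>a\<bar> powr s"
proof (cases "a = of_int n * Ns k * deriv (\<phi> k) b")
  case True
  moreover have "0 < d * \<bar>a\<bar> powr s" using d a by (intro mult_pos_pos) auto
  ultimately show ?thesis by simp
next
  case False
  let ?x = "of_int n * Ns k * deriv (\<phi> k) b"
  obtain e where e: "0 < e" "ball (a, b) e \<subseteq> Z_set d s Ns \<phi> n k"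
    using int by (auto simp: mem_interior)
  define t where "t = min (e / 2) ((\<bar>a\<bar> - 1) / 2)"
  define a' where "a' = a + t * sgn (a - ?x)"
  have t: "0 < t" "t < e" "t < \<bar>a\<bar> - 1" using e a by (auto simp: t_def min_def field_simps)
  have dist: "\<bar>a' - ?x\<bar> = \<bar>a - ?x\<bar> + t" "\<bar>a' - a\<bar> = t"
    using t False by (auto simp: a'_def sgn_if abs_if split: if_splits)
  have "(a', b) \<in> ball (a, b) e" using t dist by (simp add: dist_Pair_Pair dist_real_def)
  then have "\<bar>a' - ?x\<bar> \<le> d * \<bar>a'\<bar> powr s" using e by (auto simp: Z_set_def)
  moreover have "\<bar>d * \<bar>a'\<bar> powr s - d * \<bar>a\<bar> powr s\<bar> < \<bar>a' - a\<bar>"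
    using t dist a by (intro band_width_contraction s d) auto
  ultimately show ?thesis using dist by linarith
qed

lemma band_frequency_large:
  fixes a x :: real
  assumes s: "0 < s" "s < 1" and "d \<le> 1" and X: "1 < X" "2 * X \<le> \<bar>x\<bar>"
    and band: "\<bar>a - x\<bar> \<le> d * \<bar>a\<bar> powr s"
  shows "X < \<bar>a\<bar>"
proof (rule ccontr)
  assume "\<not> X < \<bar>a\<bar>"
  then have a: "\<bar>a\<bar> \<le> X" by simp
  have "d * \<bar>a\<bar> powr s \<le> 1 * \<bar>a\<bar> powr s" using \<open>d \<le> 1\<close> by (intro mult_right_mono) auto
  also have "\<dots> \<le> X powr s" using a s by (simp add: powr_mono2)
  also have "\<dots> < X powr 1" using s X by (intro powr_less_mono) auto
  finally show False using band a X by simp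
qed

section \<open>Smallness outside the bands\<close>

lemma mother_wave_packet_fourier_zero:
  assumes "mother_wave_packet w d" "d \<le> \<bar>\<xi>\<bar>"
  shows "fourier w \<xi> = 0"
proof -
  have "\<xi> \<notin> {\<xi>. fourier w \<xi> \<noteq> 0}"
    using assms by (auto simp: mother_wave_packet_def)
  then show ?thesis by simp
qed

lemma GF_data_components:
  assumes gf: "GF_data d M N K s Ns \<alpha> sh \<phi>" and k: "k \<in> {1..K}" and "0 < M"
  shows "1 \<le> M" "gimt M (\<alpha> k) (sh k) (\<phi> k)" "amplitude_phase M (\<alpha> k) (\<phi> k)" "N \<le> Ns k"
proof -
  show g: "gimt M (\<alpha> k) (sh k) (\<phi> k)" and "N \<le> Ns k" using gf k by (auto simp: GF_data_def)
  then show "amplitude_phase M (\<alpha> k) (\<phi> k)" by (simp add: gimt_def amplitude_phase_def)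
  have "1 / M \<le> M" using g unfolding gimt_def by (meson order_trans)
  then have "1 \<le> M * M" using \<open>0 < M\<close> by (simp add: field_simps)
  then show "1 \<le> M" using \<open>0 < M\<close> by (smt (verit) mult_less_cancel_left2)
qed

lemma active_nonzero:
  assumes "GF_data d M N K s Ns \<alpha> sh \<phi>" "(n, k) \<in> active K sh"
  shows "k \<in> {1..K}" "n \<noteq> 0"
proof -
  show k: "k \<in> {1..K}" using assms by (simp add: active_def)
  have "sh k \<in> shape_functions M" using assms k by (auto simp: GF_data_def gimt_def)
  then have "fourier_coeff (sh k) 0 = 0" by (rule shape_function_series(2))
  then show "n \<noteq> 0" using assms by (auto simp: active_def)
qed

text \<open>Every nonzero mode has instantaneous frequency at least \<open>N / M\<close>; together with
  \<open>band_frequency_large\<close> this forces \<open>\<bar>a\<bar>\<close> to be large on all bands at once.\<close>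
lemma mode_frequency_large:
  fixes n :: int
  assumes gf: "GF_data d M N K s Ns \<alpha> sh \<phi>" and k: "k \<in> {1..K}" and n: "n \<noteq> 0" and "0 < M"
    and X: "0 \<le> X" "2 * M * X \<le> N"
  shows "2 * M * X \<le> \<bar>of_int n * Ns k\<bar>" "2 * X \<le> \<bar>of_int n * Ns k * deriv (\<phi> k) b\<bar>"
proof -
  note c = GF_data_components[OF gf k \<open>0 < M\<close>]
  have "1 \<le> \<bar>n\<bar>" using n by linarith
  then have n1: "1 \<le> \<bar>real_of_int n\<bar>" by linarith
  have "1 * (2 * M * X) \<le> \<bar>real_of_int n\<bar> * \<bar>Ns k\<bar>"
    using c X \<open>0 < M\<close> n1 by (intro mult_mono) auto
  then show 1: "2 * M * X \<le> \<bar>of_int n * Ns k\<bar>" by (simp add: abs_mult)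
  have "2 * M * X * (1 / M) \<le> \<bar>of_int n * Ns k\<bar> * \<bar>deriv (\<phi> k) b\<bar>"
    using 1 c(3) \<open>0 < M\<close> by (intro mult_mono) (auto simp: amplitude_phase_def)
  then show "2 * X \<le> \<bar>of_int n * Ns k * deriv (\<phi> k) b\<bar>"
    using \<open>0 < M\<close> by (simp add: abs_mult)
qed

text \<open>No mode resonates with the packet outside the open bands, so the whole superposition is small
  there. The estimate is uniform in the data and tends to zero as \<open>X\<close>, and with it \<open>N\<close>, grows.\<close>
lemma wp_transform_outside_bands:
  assumes w: "mother_wave_packet w d" and "0 < M" and s: "1 / 2 < s" "s < 1"
    and gf: "GF_data d M N K s Ns \<alpha> sh \<phi>" and X: "1 \<le> X" "2 * M * X \<le> N" and a: "1 \<le> \<bar>a\<bar>"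
    and off: "\<And>n k. (n, k) \<in> active K sh \<Longrightarrow>
      d * \<bar>a\<bar> powr s \<le> \<bar>a - of_int n * Ns k * deriv (\<phi> k) b\<bar>"
  shows "cmod (wp_transform w s (superposition K Ns \<alpha> sh \<phi>) a b) \<le> \<bar>a\<bar> powr (- s / 2) *
    (of_nat K * (M * (packet_norm w * (14 * M ^ 3 * (X powr (s - 1) + X powr (1 - 2 * s))))))"
proof -
  let ?\<eta> = "packet_norm w * (14 * M ^ 3 * (X powr (s - 1) + X powr (1 - 2 * s)))"
  note comp = GF_data_components[OF gf _ \<open>0 < M\<close>]
  have sw: "schwartz w" using w by (simp add: mother_wave_packet_def)
  have iw: "integrable lborel w" using schwartz_integrable[OF sw, of 0] by simp
  have M: "1 \<le> M" if "K \<noteq> 0" using comp(1)[of 1] that by simp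
  have \<eta>: "0 \<le> ?\<eta>" using \<open>0 < M\<close> packet_norm_bounds(4)[of w] by simp
  have mode: "cmod (packet_pairing w (\<bar>a\<bar> powr (- s)) a b
        (\<lambda>t. of_real (\<alpha> k t) * cis (2 * pi * (of_int n * Ns k) * \<phi> k t))) \<le> ?\<eta>"
    if nk: "(n, k) \<in> active K sh" for n k
  proof (rule pairing_oscillation_bound[OF sw mother_wave_packet_fourier_zero[OF w]])
    note k = active_nonzero[OF gf nk]
    show "amplitude_phase M (\<alpha> k) (\<phi> k)" "1 \<le> M" using comp k by auto
    show "2 * M * X \<le> \<bar>of_int n * Ns k\<bar>"
      using X \<open>0 < M\<close> by (intro mode_frequency_large(1)[OF gf k(1) k(2)]) auto
    have "\<bar>a\<bar> powr (- s) * (d * \<bar>a\<bar> powr s) \<le>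
        \<bar>a\<bar> powr (- s) * \<bar>a - of_int n * Ns k * deriv (\<phi> k) b\<bar>"
      by (intro mult_left_mono off[OF nk]) simp
    then show "d \<le> \<bar>a\<bar> powr (- s) * \<bar>a - of_int n * Ns k * deriv (\<phi> k) b\<bar>"
      using a by (simp add: powr_minus field_simps)
  qed (use s a X in auto)
  have "cmod (packet_pairing w (\<bar>a\<bar> powr (- s)) a b (superposition K Ns \<alpha> sh \<phi>)) \<le> of_nat K * (M * ?\<eta>)"
    by (rule pairing_superposition_bound[OF iw comp(2) M \<eta> mode])
  then show ?thesis
    by (simp add: wp_transform_eq_pairing[OF a] norm_mult mult_left_mono)
qed

lemma GF_data_separation:
  assumes gf: "GF_data d M N K s Ns \<alpha> sh \<phi>" and a: "1 \<le> \<bar>a\<bar>"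
    and p: "(n, k) \<in> active K sh" "\<bar>a - of_int n * Ns k * deriv (\<phi> k) b\<bar> < d * \<bar>a\<bar> powr s"
    and p': "(n', k') \<in> active K sh" "\<bar>a - of_int n' * Ns k' * deriv (\<phi> k') b\<bar> < d * \<bar>a\<bar> powr s"
  shows "(n, k) = (n', k')"
proof -
  have scale: "\<bar>a\<bar> powr (- s) * y < d" if "y < d * \<bar>a\<bar> powr s" for y
    using that a by (simp add: powr_minus field_simps)
  have "\<exists>\<^sub>\<le>\<^sub>1 p. p \<in> active K sh \<and> (case p of (n, k) \<Rightarrow>
           \<bar>a\<bar> powr (- s) * \<bar>a - of_int n * Ns k * deriv (\<phi> k) b\<bar> < d)"
    using gf a unfolding GF_data_def by blast
  from Uniq_D[OF this, of "(n, k)" "(n', k')"] show ?thesis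
    using p p' scale by auto
qed

theorem theorem3p4:
  fixes w :: "real \<Rightarrow> complex" and d M :: real and K :: nat
  assumes "mother_wave_packet w d" and "0 < M"
  shows "\<exists>C>0. \<forall>s::real. 1 / 2 < s \<and> s < 1 \<longrightarrow> (\<forall>\<epsilon>>0. \<exists>N0>0. \<forall>N>N0. \<forall>Ns \<alpha> sh \<phi>.
    GF_data d M N K s Ns \<alpha> sh \<phi> \<longrightarrow>
      (let f = superposition K Ns \<alpha> sh \<phi>; R = R_set w s f \<epsilon>; Z = Z_set d s Ns \<phi> in
        disjoint_family_on (\<lambda>(n, k). interior (Z n k)) (active K sh) \<and>
        disjoint_family_on (\<lambda>(n, k). R \<inter> Z n k) (active K sh) \<and>
        R \<subseteq> (\<Union>(n, k)\<in>active K sh. Z n k) \<and>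
        (\<forall>n k. 1 \<le> \<bar>n\<bar> \<and> k \<in> {1..K} \<longrightarrow> (\<forall>(a, b) \<in> R \<inter> Z n k.
           \<exists>v. inst_freq w s f a b = Some v \<and>
             cmod (v - of_real (of_int n * Ns k * deriv (\<phi> k) b)) /
               \<bar>of_int n * Ns k * deriv (\<phi> k) b\<bar> \<le> C * sqrt \<epsilon>))))"
  \<comment> \<open>The relative error tends to zero with \<open>1 / N\<close>, so \<open>C = 1\<close> is reached by enlarging \<open>N0\<close>,
    which may depend on \<open>\<epsilon>\<close>.\<close>
proof (rule exI[of _ 1], intro conjI allI impI)
  show "(0::real) < 1" by simp
  fix s \<epsilon> :: real
  assume "1 / 2 < s \<and> s < 1" and \<epsilon>: "0 < \<epsilon>"
  then have s: "1 / 2 < s" "s < 1" by auto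
  have s0: "0 < s" using s by linarith
  have sw: "schwartz w" and d: "0 < d" "d \<le> 1"
    using assms by (auto simp: mother_wave_packet_def)
  \<comment> \<open>\<open>E X\<close> bounds the normalised transform off the bands, and \<open>Q\<close> the distance of the instantaneous
    frequency from \<open>a\<close> in units of \<open>\<bar>a\<bar>\<^sup>s\<close>.\<close>
  define E where "E X = of_nat K * (M * (packet_norm w *
    (14 * M ^ 3 * (X powr (s - 1) + X powr (1 - 2 * s)))))" for X
  define Q where "Q = of_nat K * M\<^sup>2 * (LINT u|lborel. cmod (nth_vderiv 1 w u)) / sqrt \<epsilon>"
  have Q0: "0 \<le> Q" using \<epsilon> by (simp add: Q_def integral_nonneg_AE)
  have lim: "((\<lambda>X. X powr (s - 1)) \<longlongrightarrow> 0) at_top" "((\<lambda>X. X powr (1 - 2 * s)) \<longlongrightarrow> 0) at_top"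
    using s by (auto intro!: tendsto_neg_powr filterlim_ident)
  have "(E \<longlongrightarrow> 0) at_top"
    unfolding E_def using tendsto_add[OF lim] by (intro tendsto_mult_right_zero) simp
  then have "\<forall>\<^sub>F X in at_top. E X < sqrt \<epsilon>" using \<epsilon> by (intro order_tendstoD) auto
  moreover have "\<forall>\<^sub>F X in at_top. X powr (s - 1) < 1 / 2"
    by (rule order_tendstoD[OF lim(1)]) simp
  moreover have "\<forall>\<^sub>F X in at_top. 2 * (Q + 1) * X powr (s - 1) < sqrt \<epsilon>"
    using \<epsilon> by (intro order_tendstoD[OF tendsto_mult_right_zero[OF lim(1)]]) auto
  moreover have "\<forall>\<^sub>F X::real in at_top. 1 < X" by (rule eventually_gt_at_top)
  ultimately have "\<forall>\<^sub>F X in at_top. E X < sqrt \<epsilon> \<and> X powr (s - 1) < 1 / 2 \<and>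
      2 * (Q + 1) * X powr (s - 1) < sqrt \<epsilon> \<and> 1 < X"
    by eventually_elim auto
  then obtain X where X: "E X < sqrt \<epsilon>" "X powr (s - 1) < 1 / 2"
      "2 * (Q + 1) * X powr (s - 1) < sqrt \<epsilon>" "1 < X"
    using eventually_happens'[OF trivial_limit_at_top_linorder] by blast
  show "\<exists>N0>0. \<forall>N>N0. \<forall>Ns \<alpha> sh \<phi>.
    GF_data d M N K s Ns \<alpha> sh \<phi> \<longrightarrow>
      (let f = superposition K Ns \<alpha> sh \<phi>; R = R_set w s f \<epsilon>; Z = Z_set d s Ns \<phi> in
        disjoint_family_on (\<lambda>(n, k). interior (Z n k)) (active K sh) \<and>
        disjoint_family_on (\<lambda>(n, k). R \<inter> Z n k) (active K sh) \<and>
        R \<subseteq> (\<Union>(n, k)\<in>active K sh. Z n k) \<and>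
        (\<forall>n k. 1 \<le> \<bar>n\<bar> \<and> k \<in> {1..K} \<longrightarrow> (\<forall>(a, b) \<in> R \<inter> Z n k.
           \<exists>v. inst_freq w s f a b = Some v \<and>
             cmod (v - of_real (of_int n * Ns k * deriv (\<phi> k) b)) /
               \<bar>of_int n * Ns k * deriv (\<phi> k) b\<bar> \<le> 1 * sqrt \<epsilon>)))"
  proof (intro exI[of _ "2 * M * X"] conjI allI impI)
    show "0 < 2 * M * X" using \<open>0 < M\<close> X by simp
    fix N Ns \<alpha> sh \<phi>
    assume N: "2 * M * X < N" and gf: "GF_data d M N K s Ns \<alpha> sh \<phi>"
    let ?f = "superposition K Ns \<alpha> sh \<phi>"
    let ?R = "R_set w s ?f \<epsilon>" and ?Z = "Z_set d s Ns \<phi>"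
    let ?x = "\<lambda>n k b. of_int n * Ns k * deriv (\<phi> k) b"
    note comp = GF_data_components[OF gf _ \<open>0 < M\<close>]
    have M: "1 \<le> M" if "K \<noteq> 0" using comp(1)[of 1] that by simp
    note f = superposition_regular[where K = K and M = M and \<alpha> = \<alpha> and sh = sh and \<phi> = \<phi> and Ns = Ns, OF comp(2) M]
    have centre: "2 * X \<le> \<bar>?x n k b\<bar>" if "k \<in> {1..K}" "n \<noteq> 0" for n k b
      using mode_frequency_large(2)[OF gf that \<open>0 < M\<close>, of X b] X N by simp
    have large: "X < \<bar>a\<bar>" if "k \<in> {1..K}" "n \<noteq> 0" "(a, b) \<in> ?Z n k" for n k a b
      using band_frequency_large[OF s0 s(2) d(2) X(4) centre[OF that(1,2)]] that(3)
      by (simp add: Z_set_def)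
    have R_open_band: "\<exists>n k. (n, k) \<in> active K sh \<and> \<bar>a - ?x n k b\<bar> < d * \<bar>a\<bar> powr s"
      if "(a, b) \<in> ?R" for a b
    proof (rule ccontr)
      assume "\<not> ?thesis"
      then have off: "d * \<bar>a\<bar> powr s \<le> \<bar>a - ?x n k b\<bar>" if "(n, k) \<in> active K sh" for n k
        using that by force
      have a: "1 \<le> \<bar>a\<bar>" using that by (simp add: R_set_def)
      have "cmod (wp_transform w s ?f a b) \<le> \<bar>a\<bar> powr (- s / 2) * E X"
        unfolding E_def using X N
        by (intro wp_transform_outside_bands[OF assms s gf _ _ a off]) auto
      also have "\<dots> < \<bar>a\<bar> powr (- s / 2) * sqrt \<epsilon>"
        using a X by (intro mult_strict_left_mono) auto
      finally show False using that by (simp add: R_set_def)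
    qed
    have interiors_disjoint: False
      if p: "(n, k) \<in> active K sh" "(n', k') \<in> active K sh" "(n, k) \<noteq> (n', k')"
        and ab: "(a, b) \<in> interior (?Z n k)" "(a, b) \<in> interior (?Z n' k')" for n k n' k' a b
    proof -
      have "(a, b) \<in> ?Z n k" using ab(1) interior_subset by blast
      then have a: "1 < \<bar>a\<bar>" using large[OF active_nonzero[OF gf p(1)]] X by force
      show False
        using GF_data_separation[OF gf less_imp_le[OF a] p(1) interior_Z_set[OF s0 s(2) d a ab(1)]
            p(2) interior_Z_set[OF s0 s(2) d a ab(2)]] p(3) by simp
    qed
    \<comment> \<open>A point of \<open>R\<close> lies in an open band; a closed band of another mode containing it would make the
      two open bands meet.\<close>
    have no_other: False
      if p: "(n, k) \<in> active K sh" "(n', k') \<in> active K sh" "(n, k) \<noteq> (n', k')"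
        and ab: "(a, b) \<in> ?Z n k" "\<bar>a - ?x n' k' b\<bar> < d * \<bar>a\<bar> powr s" for n k n' k' a b
    proof -
      have a: "1 < \<bar>a\<bar>" using large[OF active_nonzero[OF gf p(1)] ab(1)] X by force
      have "\<bar>a - ?x n k b\<bar> \<le> d * \<bar>a\<bar> powr s" using ab(1) by (simp add: Z_set_def)
      then obtain a' where a': "1 \<le> \<bar>a'\<bar>" "\<bar>a' - ?x n k b\<bar> < d * \<bar>a'\<bar> powr s"
        "\<bar>a' - ?x n' k' b\<bar> < d * \<bar>a'\<bar> powr s"
        using closed_band_meets_open_band[OF s0 s(2) d a _ ab(2)] by blast
      show False using GF_data_separation[OF gf a'(1) p(1) a'(2) p(2) a'(3)] p(3) by simp
    qed
    have R_parts_disjoint: False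
      if p: "(n, k) \<in> active K sh" "(n', k') \<in> active K sh" "(n, k) \<noteq> (n', k')"
        and ab: "(a, b) \<in> ?R" "(a, b) \<in> ?Z n k" "(a, b) \<in> ?Z n' k'" for n k n' k' a b
    proof -
      obtain m j where mj: "(m, j) \<in> active K sh" "\<bar>a - ?x m j b\<bar> < d * \<bar>a\<bar> powr s"
        using R_open_band[OF ab(1)] by blast
      show False
        using no_other[OF p(1) mj(1) _ ab(2) mj(2)] no_other[OF p(2) mj(1) _ ab(3) mj(2)] p(3)
        by auto
    qed
    have "disjoint_family_on (\<lambda>(n, k). interior (?Z n k)) (active K sh)"
      unfolding disjoint_family_on_def by (auto dest: interiors_disjoint)
    moreover have "disjoint_family_on (\<lambda>(n, k). ?R \<inter> ?Z n k) (active K sh)"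
      unfolding disjoint_family_on_def by (auto dest: R_parts_disjoint)
    moreover have "?R \<subseteq> (\<Union>(n, k)\<in>active K sh. ?Z n k)"
    proof clarify
      fix a b assume "(a, b) \<in> ?R"
      then obtain n k where "(n, k) \<in> active K sh" "\<bar>a - ?x n k b\<bar> < d * \<bar>a\<bar> powr s"
        using R_open_band by blast
      then show "(a, b) \<in> (\<Union>(n, k)\<in>active K sh. ?Z n k)"
        by (intro UN_I[of "(n, k)"]) (auto simp: Z_set_def)
    qed
    moreover have "\<exists>v. inst_freq w s ?f a b = Some v \<and>
        cmod (v - of_real (?x n k b)) / \<bar>?x n k b\<bar> \<le> 1 * sqrt \<epsilon>"
      if nk: "1 \<le> \<bar>n\<bar>" "k \<in> {1..K}" and R: "(a, b) \<in> ?R" and Z: "(a, b) \<in> ?Z n k" for n k a b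
    proof -
      have n: "n \<noteq> 0" using nk by auto
      have a: "1 \<le> \<bar>a\<bar>" and big: "\<bar>a\<bar> powr (- s / 2) * sqrt \<epsilon> \<le> cmod (wp_transform w s ?f a b)"
        using R by (auto simp: R_set_def)
      have aX: "X < \<bar>a\<bar>" by (rule large[OF nk(2) n Z])
      obtain v where v: "inst_freq w s ?f a b = Some v" "cmod (v - of_real a) \<le> \<bar>a\<bar> powr s * Q"
        using inst_freq_near_packet_frequency[OF sw f a less_imp_le[OF s0] \<epsilon> big]
        unfolding Q_def by metis
      have "\<bar>a - ?x n k b\<bar> \<le> d * \<bar>a\<bar> powr s" using Z by (simp add: Z_set_def)
      also have "\<dots> \<le> 1 * \<bar>a\<bar> powr s" using d by (intro mult_right_mono) auto
      finally have ax: "\<bar>a - ?x n k b\<bar> \<le> \<bar>a\<bar> powr s" by simp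
      have pw: "\<bar>a\<bar> powr s \<le> \<bar>a\<bar> * X powr (s - 1)"
      proof -
        have "\<bar>a\<bar> powr s = \<bar>a\<bar> * \<bar>a\<bar> powr (s - 1)"
          using a by (simp add: powr_diff)
        also have "\<dots> \<le> \<bar>a\<bar> * X powr (s - 1)"
          using aX X s by (intro mult_left_mono powr_mono2') auto
        finally show ?thesis .
      qed
      also have "\<dots> \<le> \<bar>a\<bar> * (1 / 2)" using X by (intro mult_left_mono) auto
      finally have half: "\<bar>a\<bar> / 2 \<le> \<bar>?x n k b\<bar>" using ax by linarith
      have "cmod (v - of_real (?x n k b)) \<le> cmod (v - of_real a) + cmod (of_real a - of_real (?x n k b))"
        using norm_triangle_ineq[of "v - of_real a" "of_real a - of_real (?x n k b)"] by simp
      also have "cmod (of_real a - of_real (?x n k b)) = \<bar>a - ?x n k b\<bar>"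
        by (metis of_real_diff norm_of_real)
      also have "cmod (v - of_real a) + \<bar>a - ?x n k b\<bar> \<le> \<bar>a\<bar> powr s * (Q + 1)"
        using v(2) ax by (simp add: distrib_left)
      also have "\<dots> \<le> \<bar>a\<bar> * X powr (s - 1) * (Q + 1)"
        using pw Q0 by (intro mult_right_mono) auto
      also have "\<dots> = (\<bar>a\<bar> / 2) * (2 * (Q + 1) * X powr (s - 1))" by simp
      also have "\<dots> \<le> \<bar>?x n k b\<bar> * sqrt \<epsilon>"
        using half X Q0 by (intro mult_mono) auto
      finally have "cmod (v - of_real (?x n k b)) \<le> \<bar>?x n k b\<bar> * sqrt \<epsilon>" .
      moreover have "0 < \<bar>?x n k b\<bar>" using half a by linarith
      ultimately have "cmod (v - of_real (?x n k b)) / \<bar>?x n k b\<bar> \<le> sqrt \<epsilon>"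
        by (simp add: pos_divide_le_eq mult.commute)
      with v(1) show ?thesis by auto
    qed
    ultimately show "let f = ?f; R = R_set w s f \<epsilon>; Z = ?Z in
        disjoint_family_on (\<lambda>(n, k). interior (Z n k)) (active K sh) \<and>
        disjoint_family_on (\<lambda>(n, k). R \<inter> Z n k) (active K sh) \<and>
        R \<subseteq> (\<Union>(n, k)\<in>active K sh. Z n k) \<and>
        (\<forall>n k. 1 \<le> \<bar>n\<bar> \<and> k \<in> {1..K} \<longrightarrow> (\<forall>(a, b) \<in> R \<inter> Z n k.
           \<exists>v. inst_freq w s f a b = Some v \<and>
             cmod (v - of_real (?x n k b)) / \<bar>?x n k b\<bar> \<le> 1 * sqrt \<epsilon>))"
      unfolding Let_def by blast
  qed
qed

end
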